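(* Let $m\ge 1$, $h\ge 0$, $q>0$, let $F:\mathbb{R}_+^{m+1}\to\mathbb{R}_+$, $(s_0,s_1,\dots,s_m)\mapsto F(s_0,\dots,s_m)$, and $f_j:\mathbb{R}_+\to\mathbb{R}_+$ ($j=1,\dots,m$) be continuous functions differentiable at the origin with $F(0)=0$, $f_j(0)=0$, $F_{s_0}(0)=0$, and $F_{s_j}(0)\ge 0$, $f_j'(0)\ge 0$ for all $j=1,\dots,m$. Let $K_1,\dots,K_m:\mathbb{R}\to\mathbb{R}$ be kernels such that, for each $j$, $K_j\ge 0$, $\int_{\mathbb{R}}K_j(s)e^{\lambda s}ds$ is finite for all $\lambda\in\mathbb{R}$, and $\int_{\mathbb{R}}K_j(s)ds=1$. Put $p:=\sum_{j=1}^m F_{s_j}(0)f_j'(0)$ and assume $p>q>0$. Consider the equation $$u_t = u_{xx} - qu + F(u,\mathcal{K}_1u,\dots,\mathcal{K}_mu),\qquad (\mathcal{K}_ju)(t,x):=\int_{\mathbb{R}}K_j(x-y)f_j(u(t-h,y))\,dy, \qquad ( * )$$ and let $c_*\ge c_\#\ge 0$ be the critical speeds associated with $h,p,q$ and the kernel $K(s):=p^{-1}\sum_{j=1}^mF_{s_j}(0)f_j'(0)K_j(s)$ as defined in the context. Let $u(t,x)=\phi(x+ct)$, $c>0$, be a positive bounded solution of $( * )$. If $c<c_*$, then $\liminf_{s\to-\infty}\phi(s)>0$, and therefore $\phi(x+ct)$ is not a semi-wavefront. If $c>c_\#$, then $\liminf_{s\to+\infty}\phi(s)>0$. In consequence,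 equation $( * )$ does not have non-stationary pulses, i.e. there is no pulse $u(t,x)=\phi(x+ct)$ with $c\neq 0$.
   Context: Critical speeds: for $h\ge0$, $p>q>0$ and a kernel $K\ge 0$ with $\int_{\mathbb{R}}K=1$ and $\int_{\mathbb{R}}K(s)e^{\lambda s}ds<\infty$ for all $\lambda\in\mathbb{R}$, put $$\psi(z,\epsilon)=\epsilon z^2-z-q+p\,e^{-zh}\int_{\mathbb{R}}K(s)e^{-\sqrt{\epsilon}\,zs}ds .$$ There are uniquely determined extended positive numbers $0<\epsilon_0\le\epsilon_1\le+\infty$, $\epsilon_i=\epsilon_i(h,p,q)$ (depending also on $K$), such that: for $\epsilon\in(0,\epsilon_0)$ the equation $\psi(z,\epsilon)=0$ has exactly two real roots $z$, both positive; for $\epsilon\in(\epsilon_0,\epsilon_1)$, $\psi(z,\epsilon)>0$ for all $z\in\mathbb{R}$; for $\epsilon\in(\epsilon_1,\infty)$ the equation $\psi(z,\epsilon)=0$ has exactly two real roots, both negative. Moreover $\epsilon_0=\epsilon_1$ if and only if $\epsilon_0=\epsilon_1=+\infty$. Set $c_*:=1/\sqrt{\epsilon_0}$, $c_\#:=1/\sqrt{\epsilon_1}$ (with $1/\sqrt{+\infty}=0$). A semi-wavefront is a bounded positive classical solution of the form $u(t,x)=\phi(x+ct)$ with $\phi(-\infty)=0$. A pulse is a semi-wavefront whose profile also satisfies $\phi(+\infty)=0$. Solutions are understood in the classical sense, and $\mathbb{R}_+=[0,\infty)$. *)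

theory Defs
  imports "HOL-Analysis.Analysis"
begin

definition psi :: "real \<Rightarrow> real \<Rightarrow> real \<Rightarrow> (real \<Rightarrow> real) \<Rightarrow> real \<Rightarrow> real \<Rightarrow> real" where
  "psi h p q K z \<epsilon> = \<epsilon> * z\<^sup>2 - z - q
     + p * exp (- (z * h)) * (LINT s|lebesgue. K s * exp (- (sqrt \<epsilon> * z * s)))"

definition critical_pair ::
  "real \<Rightarrow> real \<Rightarrow> real \<Rightarrow> (real \<Rightarrow> real) \<Rightarrow> ereal \<Rightarrow> ereal \<Rightarrow> bool" where
  "critical_pair h p q K e0 e1 \<longleftrightarrow>
     0 < e0 \<and> e0 \<le> e1 \<and>
     (\<forall>\<epsilon>::real. 0 < ereal \<epsilon> \<and> ereal \<epsilon> < e0 \<longrightarrow>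
        card {z. psi h p q K z \<epsilon> = 0} = 2 \<and> (\<forall>z. psi h p q K z \<epsilon> = 0 \<longrightarrow> 0 < z)) \<and>
     (\<forall>\<epsilon>::real. e0 < ereal \<epsilon> \<and> ereal \<epsilon> < e1 \<longrightarrow> (\<forall>z. 0 < psi h p q K z \<epsilon>)) \<and>
     (\<forall>\<epsilon>::real. e1 < ereal \<epsilon> \<longrightarrow>
        card {z. psi h p q K z \<epsilon> = 0} = 2 \<and> (\<forall>z. psi h p q K z \<epsilon> = 0 \<longrightarrow> z < 0))"

text \<open>For \<open>h \<ge> 0\<close>, \<open>p > q > 0\<close> and a nonnegative kernel of mass one having all exponential
  moments there is exactly one critical pair, so the description below denotes it.\<close>

definition critical_eps :: "real \<Rightarrow> real \<Rightarrow> real \<Rightarrow> (real \<Rightarrow> real) \<Rightarrow> ereal \<times> ereal" where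
  "critical_eps h p q K = (THE e. critical_pair h p q K (fst e) (snd e))"

definition inv_sqrt :: "ereal \<Rightarrow> real" where
  "inv_sqrt e = (if e = \<infinity> then 0 else 1 / sqrt (real_of_ereal e))"

definition c_star :: "real \<Rightarrow> real \<Rightarrow> real \<Rightarrow> (real \<Rightarrow> real) \<Rightarrow> real" where
  "c_star h p q K = inv_sqrt (fst (critical_eps h p q K))"

definition c_sharp :: "real \<Rightarrow> real \<Rightarrow> real \<Rightarrow> (real \<Rightarrow> real) \<Rightarrow> real" where
  "c_sharp h p q K = inv_sqrt (snd (critical_eps h p q K))"

text \<open>The orthant of points \<open>(s\<^sub>0, (s\<^sub>1, \<dots>, s\<^sub>m))\<close> with nonnegative coordinates, where
  \<open>m = CARD('m)\<close>; index types are nonempty, so \<open>m \<ge> 1\<close>.\<close>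

definition orthant :: "(real \<times> (real ^ 'm)) set" where
  "orthant = {(s0, s). 0 \<le> s0 \<and> (\<forall>j. 0 \<le> s $ j)}"

definition nonlocal_op ::
  "real \<Rightarrow> (real \<Rightarrow> real) \<Rightarrow> (real \<Rightarrow> real) \<Rightarrow> (real \<Rightarrow> real \<Rightarrow> real) \<Rightarrow> real \<Rightarrow> real \<Rightarrow> real" where
  "nonlocal_op h K f u t x = (LINT y|lebesgue. K (x - y) * f (u (t - h) y))"

definition classical_solution ::
  "real \<Rightarrow> real \<Rightarrow> (real \<times> (real ^ 'm) \<Rightarrow> real) \<Rightarrow> ('m \<Rightarrow> real \<Rightarrow> real) \<Rightarrow> ('m \<Rightarrow> real \<Rightarrow> real)
    \<Rightarrow> (real \<Rightarrow> real \<Rightarrow> real) \<Rightarrow> bool" where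
  "classical_solution h q F K f u \<longleftrightarrow>
     (\<exists>ut ux uxx.
        (\<forall>t x. ((\<lambda>t. u t x) has_real_derivative ut t x) (at t)
             \<and> ((\<lambda>x. u t x) has_real_derivative ux t x) (at x)
             \<and> ((\<lambda>x. ux t x) has_real_derivative uxx t x) (at x)) \<and>
        continuous_on UNIV (\<lambda>(t, x). ut t x) \<and>
        continuous_on UNIV (\<lambda>(t, x). ux t x) \<and>
        continuous_on UNIV (\<lambda>(t, x). uxx t x) \<and>
        (\<forall>t x. ut t x = uxx t x - q * u t x
             + F (u t x, \<chi> j. nonlocal_op h (K j) (f j) u t x)))"

definition travelling_solution ::
  "real \<Rightarrow> real \<Rightarrow> (real \<times> (real ^ 'm) \<Rightarrow> real) \<Rightarrow> ('m \<Rightarrow> real \<Rightarrow> real) \<Rightarrow> ('m \<Rightarrow> real \<Rightarrow> real)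
    \<Rightarrow> (real \<Rightarrow> real) \<Rightarrow> real \<Rightarrow> bool" where
  "travelling_solution h q F K f \<phi> c \<longleftrightarrow>
     classical_solution h q F K f (\<lambda>t x. \<phi> (x + c * t)) \<and> (\<forall>s. 0 < \<phi> s) \<and> bounded (range \<phi>)"

definition semi_wavefront ::
  "real \<Rightarrow> real \<Rightarrow> (real \<times> (real ^ 'm) \<Rightarrow> real) \<Rightarrow> ('m \<Rightarrow> real \<Rightarrow> real) \<Rightarrow> ('m \<Rightarrow> real \<Rightarrow> real)
    \<Rightarrow> (real \<Rightarrow> real) \<Rightarrow> real \<Rightarrow> bool" where
  "semi_wavefront h q F K f \<phi> c \<longleftrightarrow>
     travelling_solution h q F K f \<phi> c \<and> (\<phi> \<longlongrightarrow> 0) at_bot"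

definition pulse ::
  "real \<Rightarrow> real \<Rightarrow> (real \<times> (real ^ 'm) \<Rightarrow> real) \<Rightarrow> ('m \<Rightarrow> real \<Rightarrow> real) \<Rightarrow> ('m \<Rightarrow> real \<Rightarrow> real)
    \<Rightarrow> (real \<Rightarrow> real) \<Rightarrow> real \<Rightarrow> bool" where
  "pulse h q F K f \<phi> c \<longleftrightarrow> semi_wavefront h q F K f \<phi> c \<and> (\<phi> \<longlongrightarrow> 0) at_top"

end

theory Submission imports Defs
begin

text \<open>Write \<open>\<chi>(\<lambda>)\<close> for the characteristic function of the linearised profile equation. Since
  \<open>F \<ge> 0\<close>, a profile is a supersolution of \<open>\<phi>'' - c \<phi>' - q \<phi> = 0\<close>, hence \<open>\<bar>\<phi>'\<bar> \<le> \<mu> \<phi>\<close>. If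
  \<open>liminf \<phi> = 0\<close> at \<open>-\<infinity>\<close>, then \<open>ln \<phi>\<close> can be touched from below, at a point \<open>t\<^sub>0\<close> where \<open>\<phi>\<close> is
  arbitrarily small, by a parabola of arbitrarily small curvature and slope \<open>\<lambda> \<in> [0, \<mu>]\<close>. At \<open>t\<^sub>0\<close>
  this gives \<open>\<phi>' = \<lambda> \<phi>\<close>, \<open>\<phi>'' \<ge> (\<lambda>\<^sup>2 - o(1)) \<phi>\<close>, while the nonlocal terms are at least
  \<open>(1 - o(1))\<close> times their value on \<open>\<phi>(t\<^sub>0) exp (\<lambda> (t - t\<^sub>0))\<close>, because the kernels have all
  exponential moments. The equation then forces \<open>\<chi>(\<lambda>) \<le> o(1)\<close>, contradicting \<open>\<chi> > 0\<close> on
  \<open>[0, \<infinity>)\<close>, which is what \<open>c < c\<^sub>*\<close> means. The behaviour at \<open>+\<infinity>\<close> follows by reflection. A pulse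
  would make the convex function \<open>\<chi>\<close> nonpositive somewhere on each half-line, although
  \<open>\<chi>(0) = p - q > 0\<close>.\<close>

section \<open>Real functions of one variable\<close>

lemma convex_on_real_chord:
  fixes f :: "real \<Rightarrow> real"
  assumes "convex_on UNIV f" "x < y" "y < z"
  shows "(z - x) * f y \<le> (z - y) * f x + (y - x) * f z"
proof -
  define t where "t = (y - x) / (z - x)"
  have t: "0 \<le> t" "t \<le> 1" and tz: "(z - x) * t = y - x" "(z - x) * (1 - t) = z - y"
    using assms(2,3) by (auto simp: t_def field_simps)
  have "(1 - t) * x + t * z = x + (z - x) * t" by (simp add: algebra_simps)
  then have "f y \<le> (1 - t) * f x + t * f z"
    using convex_onD[OF assms(1) t, of x z] tz by simp
  then have "(z - x) * f y \<le> (z - x) * ((1 - t) * f x + t * f z)"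
    using assms(2,3) by (intro mult_left_mono) auto
  also have "\<dots> = ((z - x) * (1 - t)) * f x + ((z - x) * t) * f z" by (simp add: algebra_simps)
  finally show ?thesis unfolding tz .
qed

lemma convex_on_real_chord_neg:
  fixes f :: "real \<Rightarrow> real"
  assumes "convex_on UNIV f" "x < y" "y < z" "f x \<le> 0" "f z \<le> 0" "f x < 0 \<or> f z < 0"
  shows "f y < 0"
proof -
  have "(z - y) * f x + (y - x) * f z < 0"
    using assms(2-) mult_pos_neg[of "z - y" "f x"] mult_pos_neg[of "y - x" "f z"]
      mult_nonneg_nonpos[of "z - y" "f x"] mult_nonneg_nonpos[of "y - x" "f z"] by linarith
  with convex_on_real_chord[OF assms(1-3)] have "(z - x) * f y < 0" by linarith
  then show ?thesis using assms(2,3) by (auto simp: mult_less_0_iff)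
qed

text \<open>The intermediate value theorem gives one zero on each side of \<open>x0\<close>. Of two
  zeros on the same side, the one nearer to \<open>x0\<close> would lie strictly between a zero and
  a point of negativity, where convexity makes \<open>f\<close> negative.\<close>

lemma convex_on_real_two_zeros_pos:
  fixes f :: "real \<Rightarrow> real"
  assumes f: "convex_on UNIV f" and "0 < f 0" "0 < x0" "f x0 < 0" "x0 < x1" "0 < f x1"
  shows "card {x. f x = 0} = 2 \<and> (\<forall>x. f x = 0 \<longrightarrow> 0 < x)"
proof -
  have cont: "continuous_on A f" for A
    using convex_on_continuous[OF open_UNIV f] continuous_on_subset by blast
  obtain a where a: "0 \<le> a" "a \<le> x0" "f a = 0"
    using IVT2'[of f x0 0 0] assms cont by auto
  obtain b where b: "x0 \<le> b" "b \<le> x1" "f b = 0"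
    using IVT'[of f x0 0 x1] assms cont by auto
  have "a \<noteq> 0" "a \<noteq> x0" "b \<noteq> x0" using a b assms by auto
  with a b have ab: "0 < a" "a < x0" "x0 < b" by auto
  have "x = a \<or> x = b" if x: "f x = 0" for x
  proof (rule ccontr)
    assume ne: "\<not> ?thesis"
    have "x \<noteq> x0" using x assms(4) by auto
    then consider "x < a" | "a < x" "x < x0" | "x0 < x" "x < b" | "b < x"
      using ne by linarith
    then show False
      by cases (use convex_on_real_chord_neg[OF f, of x a x0] convex_on_real_chord_neg[OF f, of a x x0]
          convex_on_real_chord_neg[OF f, of x0 x b] convex_on_real_chord_neg[OF f, of x0 b x]
          ab a b x assms(4) in auto)
  qed
  then have "{x. f x = 0} = {a, b}" using a b by auto
  then show ?thesis using ab by auto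
qed

lemma convex_on_real_two_zeros_neg:
  fixes f :: "real \<Rightarrow> real"
  assumes f: "convex_on UNIV f" and "0 < f 0" "x0 < 0" "f x0 < 0" "x1 < x0" "0 < f x1"
  shows "card {x. f x = 0} = 2 \<and> (\<forall>x. f x = 0 \<longrightarrow> x < 0)"
proof -
  have "convex_on UNIV (\<lambda>x. f (- x))"
  proof
    fix t x y :: real assume "0 < t" "t < 1"
    then show "f (- ((1 - t) *\<^sub>R x + t *\<^sub>R y)) \<le> (1 - t) * f (- x) + t * f (- y)"
      using convex_onD[OF f, of t "- x" "- y"] by (simp add: algebra_simps)
  qed auto
  from convex_on_real_two_zeros_pos[OF this, of "- x0" "- x1"]
  have *: "card {x. f (- x) = 0} = 2" "\<And>x. f (- x) = 0 \<Longrightarrow> 0 < x" using assms(2-) by auto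
  have "{x. f x = 0} = uminus ` {x. f (- x) = 0}"
    by (force simp: image_iff intro: exI[of _ "- x" for x])
  then have "card {x. f x = 0} = 2" using *(1) by (simp add: card_image)
  then show ?thesis using *(2)[of "- x" for x] by fastforce
qed

section \<open>Logarithmic derivative of positive supersolutions\<close>

text \<open>The operator factors as \<open>(D - z2) (D - z1)\<close>, so
  \<open>w = \<phi>1 - z1 * \<phi>\<close> satisfies \<open>w' \<le> z2 * w\<close>. Once negative,
  \<open>w\<close> stays below that negative value, and so does \<open>\<phi>1\<close> because
  \<open>z1 < 0\<close>; then \<open>\<phi>\<close> reaches zero in finite time.\<close>

lemma supersolution_deriv_ge:
  fixes \<phi> :: "real \<Rightarrow> real"
  assumes pos: "\<And>t. 0 < \<phi> t"
    and d1: "\<And>t. (\<phi> has_real_derivative \<phi>1 t) (at t)"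
    and d2: "\<And>t. (\<phi>1 has_real_derivative \<phi>2 t) (at t)"
    and z: "z1 < 0" "0 < z2"
    and le: "\<And>t. \<phi>2 t \<le> (z1 + z2) * \<phi>1 t - z1 * z2 * \<phi> t"
  shows "z1 * \<phi> t0 \<le> \<phi>1 t0"
proof (rule ccontr)
  define w where "w t = \<phi>1 t - z1 * \<phi> t" for t
  assume "\<not> ?thesis"
  then have w0: "w t0 < 0" by (simp add: w_def)
  have wd: "((\<lambda>t. w t * exp (- z2 * t)) has_real_derivative
      (\<phi>2 t - (z1 + z2) * \<phi>1 t + z1 * z2 * \<phi> t) * exp (- z2 * t)) (at t)" for t
    unfolding w_def
    by (auto intro!: derivative_eq_intros d1 d2 simp: algebra_simps)
  have "w t \<le> w t0" if "t0 \<le> t" for t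
  proof -
    have "w t * exp (- z2 * t) \<le> w t0 * exp (- z2 * t0)"
    proof (rule DERIV_nonpos_imp_nonincreasing[OF that])
      fix x
      have "(\<phi>2 x - (z1 + z2) * \<phi>1 x + z1 * z2 * \<phi> x) * exp (- z2 * x) \<le> 0"
        using le[of x] by (intro mult_nonpos_nonneg) auto
      then show "\<exists>y. ((\<lambda>t. w t * exp (- z2 * t)) has_real_derivative y) (at x) \<and> y \<le> 0"
        using wd by blast
    qed
    then have "w t \<le> w t0 * exp (z2 * (t - t0))"
      by (simp add: exp_minus right_diff_distrib exp_diff divide_simps)
    also have "\<dots> \<le> w t0 * 1"
      using w0 z that by (intro mult_left_mono_neg) auto
    finally show ?thesis by simp
  qed
  then have dec: "\<phi>1 t \<le> w t0" if "t0 \<le> t" for t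
    using that mult_neg_pos[OF z(1) pos[of t]] by (fastforce simp: w_def)
  \<comment> \<open>This is where the line through \<open>(t0, \<phi> t0)\<close> of slope
    \<open>w t0\<close> meets zero.\<close>
  define T where "T = t0 + \<phi> t0 / (- w t0)"
  have T: "t0 < T" using w0 pos[of t0] by (simp add: T_def divide_pos_neg)
  obtain x where x: "t0 < x" "x < T" "\<phi> T - \<phi> t0 = (T - t0) * \<phi>1 x"
    using MVT2[OF T, of \<phi> \<phi>1] d1 by blast
  have "(T - t0) * \<phi>1 x \<le> (T - t0) * w t0"
    using dec[of x] x T by (intro mult_left_mono) auto
  also have "\<dots> = - \<phi> t0" using w0 by (simp add: T_def)
  finally have "\<phi> T \<le> 0" using x(3) by linarith
  then show False using pos[of T] by linarith
qed

text \<open>The roots \<open>z1\<close>, \<open>z2\<close> of \<open>z\<^sup>2 - c * z - q\<close>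
  have opposite signs because \<open>q > 0\<close>. They bound the logarithmic derivative from below
  and above; the upper bound is the lower one for the reflected function.\<close>

lemma supersolution_log_deriv_bounded:
  fixes \<phi> :: "real \<Rightarrow> real"
  assumes pos: "\<And>t. 0 < \<phi> t"
    and d1: "\<And>t. (\<phi> has_real_derivative \<phi>1 t) (at t)"
    and d2: "\<And>t. (\<phi>1 has_real_derivative \<phi>2 t) (at t)"
    and q: "q > 0"
    and le: "\<And>t. \<phi>2 t \<le> c * \<phi>1 t + q * \<phi> t"
  obtains \<mu> where "0 < \<mu>" "\<And>t. \<bar>\<phi>1 t\<bar> \<le> \<mu> * \<phi> t"
proof -
  define r where "r = sqrt (c\<^sup>2 + 4 * q)"
  have r: "\<bar>c\<bar> < r" unfolding r_def using q by (intro real_less_rsqrt) simp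
  have r2: "r\<^sup>2 = c\<^sup>2 + 4 * q" unfolding r_def using q by simp
  define z1 where "z1 = (c - r) / 2"
  define z2 where "z2 = (c + r) / 2"
  have z: "z1 < 0" "0 < z2" using r by (auto simp: z1_def z2_def)
  have zz: "z1 + z2 = c" "z1 * z2 = - q"
    using r2 by (auto simp: z1_def z2_def field_simps power2_eq_square)
  have lo: "z1 * \<phi> t \<le> \<phi>1 t" for t
    by (rule supersolution_deriv_ge[OF pos d1 d2 z]) (use le zz in simp)
  have up: "\<phi>1 t \<le> z2 * \<phi> t" for t
  proof -
    have a: "((\<lambda>t. \<phi> (- t)) has_real_derivative - \<phi>1 (- s)) (at s)" for s
      using d1[of "- s"] by (simp add: DERIV_mirror)
    have b: "((\<lambda>t. - \<phi>1 (- t)) has_real_derivative \<phi>2 (- s)) (at s)" for s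
      using DERIV_minus[of "\<lambda>t. \<phi>1 (- t)" "- \<phi>2 (- s)"] d2[of "- s"] by (simp add: DERIV_mirror)
    \<comment> \<open>Reflection replaces the roots by their negatives, so \<open>- z2\<close> is
      now the negative root.\<close>
    have "- z2 * \<phi> (- (- t)) \<le> - \<phi>1 (- (- t))"
    proof (rule supersolution_deriv_ge[where \<phi> = "\<lambda>t. \<phi> (- t)" and ?\<phi>1.0 = "\<lambda>t. - \<phi>1 (- t)"
          and ?\<phi>2.0 = "\<lambda>t. \<phi>2 (- t)" and ?z2.0 = "- z1"])
      fix s
      have "(- z2 + - z1) * - \<phi>1 (- s) - - z2 * - z1 * \<phi> (- s)
          = (z1 + z2) * \<phi>1 (- s) - (z1 * z2) * \<phi> (- s)"
        by (simp add: algebra_simps)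
      then show "\<phi>2 (- s) \<le> (- z2 + - z1) * - \<phi>1 (- s) - - z2 * - z1 * \<phi> (- s)"
        unfolding zz using le[of "- s"] by simp
    qed (use a b pos z in auto)
    then show ?thesis by simp
  qed
  show thesis
  proof
    show "0 < r + \<bar>c\<bar>" using r by simp
    show "\<bar>\<phi>1 t\<bar> \<le> (r + \<bar>c\<bar>) * \<phi> t" for t
    proof -
      have "z2 * \<phi> t \<le> (r + \<bar>c\<bar>) * \<phi> t" "- (r + \<bar>c\<bar>) * \<phi> t \<le> z1 * \<phi> t"
        using pos[of t] r by (auto intro!: mult_right_mono simp: z1_def z2_def)
      then show ?thesis using lo[of t] up[of t] by (simp add: abs_le_iff algebra_simps)
    qed
  qed
qed

section \<open>Touching from below\<close>

lemma second_deriv_nonneg_at_local_min: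
  fixes G :: "real \<Rightarrow> real"
  assumes d1: "\<And>t. (G has_real_derivative G1 t) (at t)"
    and d2: "(G1 has_real_derivative g2) (at t0)"
    and r: "0 < r" and min: "\<And>t. \<bar>t - t0\<bar> < r \<Longrightarrow> G t0 \<le> G t"
  shows "G1 t0 = 0" "0 \<le> g2"
proof -
  show 0: "G1 t0 = 0"
    by (rule DERIV_local_min[OF d1 r]) (auto intro!: min simp: abs_minus_commute)
  show "0 \<le> g2"
  proof (rule ccontr)
    assume "\<not> 0 \<le> g2"
    then obtain d where d: "d > 0" "\<And>h. 0 < h \<Longrightarrow> h < d \<Longrightarrow> G1 (t0 + h) < 0"
      using DERIV_neg_dec_right[OF d2] 0 by auto
    define e where "e = min d r / 2"
    have e: "0 < e" "e < d" "e < r" using d(1) r by (auto simp: e_def)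
    obtain x where x: "t0 < x" "x < t0 + e" "G (t0 + e) - G t0 = (t0 + e - t0) * G1 x"
      using MVT2[of t0 "t0 + e" G G1] d1 e by auto
    have "G1 x < 0" using d(2)[of "x - t0"] x e by simp
    then have "G (t0 + e) < G t0" using x(3) mult_pos_neg[OF e(1)] by fastforce
    then show False using min[of "t0 + e"] e by simp
  qed
qed

text \<open>The difference of \<open>\<phi>\<close> and the touching function has a local minimum at
  \<open>t0\<close>, where the touching function has logarithmic slope \<open>l\<close> and second
  derivative \<open>(l\<^sup>2 - 2 * d) * \<phi> t0\<close>.\<close>

lemma lower_gaussian_touching_derivs:
  fixes \<phi> :: "real \<Rightarrow> real"
  assumes d1: "\<And>t. (\<phi> has_real_derivative \<phi>1 t) (at t)"
    and d2: "\<And>t. (\<phi>1 has_real_derivative \<phi>2 t) (at t)"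
    and r: "0 < r"
    and touch: "\<And>t. \<bar>t - t0\<bar> < r \<Longrightarrow> \<phi> t0 * exp (l * (t - t0) - d * (t - t0)\<^sup>2) \<le> \<phi> t"
  shows "\<phi>1 t0 = l * \<phi> t0" "(l\<^sup>2 - 2 * d) * \<phi> t0 \<le> \<phi>2 t0"
proof -
  define E where "E t = exp (l * (t - t0) - d * (t - t0)\<^sup>2)" for t
  define G where "G t = \<phi> t - \<phi> t0 * E t" for t
  define G1 where "G1 t = \<phi>1 t - \<phi> t0 * ((l - 2 * d * (t - t0)) * E t)" for t
  have E: "(E has_real_derivative (l - 2 * d * (t - t0)) * E t) (at t)" for t
    unfolding E_def by (auto intro!: derivative_eq_intros simp: algebra_simps)
  have G: "(G has_real_derivative G1 t) (at t)" for t
    unfolding G_def G1_def by (auto intro!: derivative_eq_intros d1 E)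
  have G1: "(G1 has_real_derivative \<phi>2 t0 - \<phi> t0 * (l\<^sup>2 - 2 * d)) (at t0)"
    unfolding G1_def
    by (auto intro!: derivative_eq_intros d2 E simp: E_def algebra_simps power2_eq_square)
  have m: "G t0 \<le> G t" if "\<bar>t - t0\<bar> < r" for t
    using touch[OF that] by (simp add: G_def E_def)
  note * = second_deriv_nonneg_at_local_min[OF G G1 r m]
  show "\<phi>1 t0 = l * \<phi> t0" using *(1) by (simp add: G1_def E_def)
  show "(l\<^sup>2 - 2 * d) * \<phi> t0 \<le> \<phi>2 t0" using *(2) by (simp add: mult.commute)
qed

text \<open>The touching parabola comes from minimising \<open>\<psi> t + d * (max 0 (s - t))\<^sup>2\<close> over \<open>t \<le> S\<close>
  with \<open>s < S\<close> chosen so that \<open>\<psi> s\<close> is far below \<open>\<psi> S\<close>: the penalty is nonincreasing, which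
  gives \<open>l \<ge> 0\<close>, and its second derivative is at most \<open>2 * d\<close>.\<close>

lemma lower_parabola_touching:
  fixes \<psi> :: "real \<Rightarrow> real"
  assumes lip: "\<And>s t. \<bar>\<psi> t - \<psi> s\<bar> \<le> \<mu> * \<bar>t - s\<bar>"
    and \<mu>: "0 < \<mu>" and d: "0 < d" and R: "0 < R"
    and low: "\<And>N T. \<exists>s\<le>T. \<psi> s \<le> N"
  obtains t0 l where "\<psi> t0 \<le> N" "0 \<le> l"
    "\<And>t. t \<le> t0 + R \<Longrightarrow> \<psi> t0 + l * (t - t0) - d * (t - t0)\<^sup>2 \<le> \<psi> t"
proof -
  define S :: real where "S = 0"
  \<comment> \<open>The drop by more than \<open>\<mu> * R\<close> keeps the minimiser, which lies
    at least as low as \<open>s\<close>, farther than \<open>R\<close> from the right end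
    \<open>S\<close>.\<close>
  obtain s where s: "s \<le> S" "\<psi> s \<le> min N (\<psi> S - \<mu> * R - 1)"
    using low by blast
  define P where "P t = d * (max 0 (s - t))\<^sup>2" for t
  \<comment> \<open>To the left of \<open>s - \<mu> / d\<close> the quadratic penalty outweighs any
    decrease allowed by the Lipschitz bound, so minimising over the compact interval from
    \<open>L\<close> to \<open>S\<close> suffices.\<close>
  define L where "L = s - \<mu> / d - 1"
  have cont: "continuous_on A \<psi>" for A
    by (rule lipschitz_on_continuous_on[of \<mu>], rule lipschitz_onI)
      (use lip \<mu> in \<open>auto simp: dist_real_def\<close>)
  have L: "L \<le> s" using divide_pos_pos[OF \<mu> d] unfolding L_def by linarith
  have "\<exists>x\<in>{L..S}. \<forall>y\<in>{L..S}. \<psi> x + P x \<le> \<psi> y + P y"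
    using L s unfolding P_def by (intro continuous_attains_inf continuous_intros cont) auto
  then obtain t0 where t0: "L \<le> t0" "t0 \<le> S"
    and min0: "\<And>y. L \<le> y \<Longrightarrow> y \<le> S \<Longrightarrow> \<psi> t0 + P t0 \<le> \<psi> y + P y"
    by auto
  have Ps: "P s = 0" by (simp add: P_def)
  have at_s: "\<psi> t0 + P t0 \<le> \<psi> s" using min0[of s] L s Ps by simp
  have min: "\<psi> t0 + P t0 \<le> \<psi> y + P y" if "y \<le> S" for y
  proof (cases "L \<le> y")
    case False
    then have y: "s - y > \<mu> / d" using L_def by simp
    then have y0: "s - y > 0" using \<mu> d by (smt (verit) divide_pos_pos)
    have "\<mu> * (s - y) \<le> d * (s - y) * (s - y)"
      using y d y0 by (intro mult_right_mono) (auto simp: field_simps)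
    then have "\<mu> * \<bar>s - y\<bar> \<le> P y" using y0 by (simp add: P_def power2_eq_square)
    then have "\<psi> s \<le> \<psi> y + P y" using lip[of s y] by linarith
    then show ?thesis using at_s by simp
  qed (use min0 that in blast)
  have P0: "P t \<ge> 0" for t using d by (simp add: P_def)
  have t0s: "\<psi> t0 \<le> \<psi> s" using at_s P0[of t0] by linarith
  \<comment> \<open>This is minus the derivative of the penalty \<open>P\<close> at
    \<open>t0\<close>.\<close>
  define l where "l = 2 * d * max 0 (s - t0)"
  have "\<mu> * R < \<mu> * (S - t0)" using lip[of S t0] t0s t0 s by auto
  then have far: "t0 + R < S" using \<mu> by simp
  show thesis
  proof
    show "\<psi> t0 \<le> N" using t0s s by simp
    show "0 \<le> l" using d by (simp add: l_def)
    fix t assume t: "t \<le> t0 + R"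
    \<comment> \<open>Expanding the right-hand square, multiplied by \<open>d\<close>, gives the
      tangent of \<open>P\<close> at \<open>t0\<close> plus
      \<open>d * (t - t0)\<^sup>2\<close>.\<close>
    have "(max 0 (s - t))\<^sup>2 \<le> (max 0 (s - t0) - (t - t0))\<^sup>2"
      by (rule abs_le_square_iff[THEN iffD1]) (auto simp: max_def)
    then have "P t \<le> d * (max 0 (s - t0) - (t - t0))\<^sup>2" using d by (simp add: P_def)
    also have "\<dots> = P t0 - l * (t - t0) + d * (t - t0)\<^sup>2"
      by (simp add: P_def l_def power2_eq_square algebra_simps)
    finally have "P t \<le> P t0 - l * (t - t0) + d * (t - t0)\<^sup>2" .
    then show "\<psi> t0 + l * (t - t0) - d * (t - t0)\<^sup>2 \<le> \<psi> t"
      using min[of t] t far by linarith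
  qed
qed

section \<open>One-sided linear bounds from the derivative at the origin\<close>

lemma has_derivative_at_0_lower:
  fixes F DF :: "'a::real_normed_vector \<Rightarrow> real"
  assumes "(F has_derivative DF) (at 0 within A)" "F 0 = 0" "0 < e"
  obtains r where "0 < r" "\<And>v. v \<in> A \<Longrightarrow> norm v < r \<Longrightarrow> DF v - e * norm v \<le> F v"
proof -
  obtain r where r: "r > 0" "\<And>v. v \<in> A \<Longrightarrow> norm (v - 0) < r \<Longrightarrow>
      norm (F v - F 0 - DF (v - 0)) \<le> e * norm (v - 0)"
    using assms(1,3) unfolding has_derivative_within_alt by meson
  have "DF v - e * norm v \<le> F v" if "v \<in> A" "norm v < r" for v
    using r(2)[OF that(1)] that(2) assms(2) by (auto simp: abs_le_iff)
  with r(1) show ?thesis using that by blast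
qed

lemma deriv_at_0_lower:
  fixes f :: "real \<Rightarrow> real"
  assumes "(f has_real_derivative a) (at 0 within {0..})" "f 0 = 0" "0 < e"
  obtains r where "0 < r" "\<And>x. 0 \<le> x \<Longrightarrow> x < r \<Longrightarrow> (a - e) * x \<le> f x"
proof -
  obtain r where r: "r > 0" "\<And>x. x \<in> {0..} \<Longrightarrow> norm x < r \<Longrightarrow> a * x - e * norm x \<le> f x"
    using has_derivative_at_0_lower[OF assms(1)[unfolded has_field_derivative_def] assms(2,3)] by blast
  show ?thesis
    by (rule that[OF r(1)]) (use r(2) in \<open>force simp: algebra_simps\<close>)
qed

text \<open>Differentiability controls \<open>f x / x\<close> near zero; away from zero a bound
  \<open>B\<close> on the compact range gives the slope \<open>\<bar>B\<bar> / r\<close>.\<close>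

lemma linear_bound_of_deriv_at_0:
  fixes f :: "real \<Rightarrow> real"
  assumes "continuous_on {0..} f" "(f has_real_derivative a) (at 0 within {0..})" "f 0 = 0"
  obtains C where "0 \<le> C" "\<And>x. 0 \<le> x \<Longrightarrow> x \<le> M \<Longrightarrow> f x \<le> C * x"
proof -
  have "((\<lambda>x. - f x) has_real_derivative - a) (at 0 within {0..})"
    using DERIV_minus[OF assms(2)] by simp
  from deriv_at_0_lower[OF this, of 1] obtain r
    where r: "r > 0" "\<And>x. 0 \<le> x \<Longrightarrow> x < r \<Longrightarrow> (- a - 1) * x \<le> - f x"
    using assms(3) by auto
  have "compact (f ` {0..M})"
    using assms(1) by (intro compact_continuous_image continuous_on_subset[OF assms(1)]) auto
  then obtain B where B: "\<And>x. 0 \<le> x \<Longrightarrow> x \<le> M \<Longrightarrow> \<bar>f x\<bar> \<le> B"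
    using compact_imp_bounded bounded_iff by (metis atLeastAtMost_iff imageI real_norm_def)
  show ?thesis
  proof
    show "0 \<le> \<bar>a\<bar> + 1 + \<bar>B\<bar> / r" using r(1) by simp
    fix x assume x: "0 \<le> x" "x \<le> M"
    show "f x \<le> (\<bar>a\<bar> + 1 + \<bar>B\<bar> / r) * x"
    proof (cases "x < r")
      case True
      have "f x \<le> (a + 1) * x" using r(2)[OF x(1) True] by (simp add: algebra_simps)
      also have "\<dots> \<le> (\<bar>a\<bar> + 1 + \<bar>B\<bar> / r) * x"
        using x r(1) by (intro mult_right_mono) (auto intro: order_trans[OF abs_ge_self])
      finally show ?thesis .
    next
      case False
      have "f x \<le> \<bar>B\<bar> / r * r" using B[OF x] r(1) by simp
      also have "\<dots> \<le> (\<bar>a\<bar> + 1 + \<bar>B\<bar> / r) * x"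
        using x r(1) False by (intro mult_mono) auto
      finally show ?thesis .
    qed
  qed
qed

section \<open>Exponential moments of kernels\<close>

text \<open>At each point the weight \<open>exp (r * \<bar>g s\<bar>)\<close> equals one of
  \<open>exp (r * g s)\<close> and \<open>exp (- r * g s)\<close>, hence is dominated by their
  sum.\<close>

lemma integrable_exp_abs:
  fixes K g :: "real \<Rightarrow> real"
  assumes K: "\<And>s. 0 \<le> K s" and g: "continuous_on UNIV g"
    and int: "\<And>r. integrable lebesgue (\<lambda>s. K s * exp (r * g s))"
  shows "integrable lebesgue (\<lambda>s. K s * exp (r * \<bar>g s\<bar>))"
proof (rule Bochner_Integration.integrable_bound)
  show "integrable lebesgue (\<lambda>s. K s * exp (r * g s) + K s * exp (- r * g s))"
    using int by (intro Bochner_Integration.integrable_add) blast+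
  \<comment> \<open>The case \<open>r = 0\<close> of the moment hypothesis supplies measurability of
    the kernel.\<close>
  have "K \<in> borel_measurable lebesgue"
    using borel_measurable_integrable[OF int[of 0]] by simp
  moreover have "g \<in> borel_measurable lebesgue"
    using borel_measurable_continuous_onI[OF g] by (simp add: measurable_completion)
  ultimately show "(\<lambda>s. K s * exp (r * \<bar>g s\<bar>)) \<in> borel_measurable lebesgue"
    by measurable
  have "K s * exp (r * \<bar>g s\<bar>) \<le> K s * exp (r * g s) + K s * exp (- r * g s)" for s
    using K[of s] by (cases "g s \<ge> 0") auto
  then show "AE s in lebesgue. norm (K s * exp (r * \<bar>g s\<bar>))
      \<le> norm (K s * exp (r * g s) + K s * exp (- r * g s))"
    using K by (auto intro!: AE_I2 simp: abs_mult)
qed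

text \<open>For each \<open>s\<close> the integrand is convex in \<open>l\<close>, and integration
  against a nonnegative kernel preserves this.\<close>

lemma convex_on_laplace_transform:
  fixes K g :: "real \<Rightarrow> real"
  assumes K: "\<And>s. 0 \<le> K s" and int: "\<And>r. integrable lebesgue (\<lambda>s. K s * exp (r * g s))"
  shows "convex_on UNIV (\<lambda>l. LINT s|lebesgue. K s * exp (- (l * g s)))"
proof
  fix t x y :: real assume t: "0 < t" "t < 1"
  have i: "integrable lebesgue (\<lambda>s. K s * exp (- (l * g s)))" for l
    using int[of "- l"] by simp
  have ex: "exp (- (((1 - t) * x + t * y) * u)) \<le> (1 - t) * exp (- (x * u)) + t * exp (- (y * u))" for u :: real
    using convex_onD[OF exp_convex, of t "- (x * u)" "- (y * u)"] t
    by (simp add: algebra_simps)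
  have "(LINT s|lebesgue. K s * exp (- (((1 - t) *\<^sub>R x + t *\<^sub>R y) * g s)))
      \<le> (LINT s|lebesgue. (1 - t) * (K s * exp (- (x * g s))) + t * (K s * exp (- (y * g s))))"
  proof (intro integral_mono i Bochner_Integration.integrable_add integrable_mult_right)
    fix s
    show "K s * exp (- (((1 - t) *\<^sub>R x + t *\<^sub>R y) * g s))
      \<le> (1 - t) * (K s * exp (- (x * g s))) + t * (K s * exp (- (y * g s)))"
      using mult_left_mono[OF ex[of "g s"] K[of s]] by (simp add: algebra_simps)
  qed
  also have "\<dots> = (1 - t) * (LINT s|lebesgue. K s * exp (- (x * g s)))
      + t * (LINT s|lebesgue. K s * exp (- (y * g s)))"
    using i by simp
  finally show "(LINT s|lebesgue. K s * exp (- (((1 - t) *\<^sub>R x + t *\<^sub>R y) * g s)))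
      \<le> (1 - t) * (LINT s|lebesgue. K s * exp (- (x * g s)))
      + t * (LINT s|lebesgue. K s * exp (- (y * g s)))" .
qed auto

text \<open>The two regimes \<open>\<bar>u\<bar> \<le> 1 / d\<close> and \<open>\<bar>u\<bar> > 1 / d\<close>: in the first the Gaussian factor costs
  \<open>d * u\<^sup>2\<close>, in the second the whole lower bound is nonpositive.\<close>

lemma nonlinear_kernel_lower_bound:
  fixes f :: "real \<Rightarrow> real"
  assumes d: "0 < d" and l: "\<bar>l\<bar> \<le> \<mu>" and \<phi>0: "0 < \<phi>0" and a: "0 \<le> a" and e: "0 \<le> e"
    and harnack: "y \<le> \<phi>0 * exp (\<mu> * \<bar>u\<bar>)"
    and touch: "\<bar>u\<bar> \<le> 1 / d \<Longrightarrow> \<phi>0 * exp (- (l * u) - d * u\<^sup>2) \<le> y"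
    and f0: "0 \<le> f y" and f: "\<bar>u\<bar> \<le> 1 / d \<Longrightarrow> (a - e) * y \<le> f y"
  shows "a * \<phi>0 * (exp (- (l * u)) - 2 * d * exp ((\<mu> + 1) * \<bar>u\<bar>)) - e * \<phi>0 * exp ((\<mu> + 1) * \<bar>u\<bar>) \<le> f y"
proof -
  have lu: "- (l * u) \<le> \<mu> * \<bar>u\<bar>"
    using l mult_right_mono[OF l, of "\<bar>u\<bar>"] by (metis abs_ge_minus_self abs_ge_zero abs_mult order_trans)
  have split: "exp ((\<mu> + 1) * \<bar>u\<bar>) = exp (\<mu> * \<bar>u\<bar>) * exp \<bar>u\<bar>"
    by (simp add: distrib_right exp_add)
  have ge1: "exp (\<mu> * \<bar>u\<bar>) \<le> exp ((\<mu> + 1) * \<bar>u\<bar>)" by (simp add: mult_right_mono)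
  show ?thesis
  proof (cases "\<bar>u\<bar> \<le> 1 / d")
    case True
    \<comment> \<open>The square is absorbed by one more unit in the exponent, which is why the
      error weight carries \<open>\<mu> + 1\<close>.\<close>
    have sq: "u\<^sup>2 \<le> 2 * exp \<bar>u\<bar>" using exp_lower_Taylor_quadratic[of "\<bar>u\<bar>"] by simp
    have "exp (- (l * u)) * (d * u\<^sup>2) \<le> exp (\<mu> * \<bar>u\<bar>) * (d * (2 * exp \<bar>u\<bar>))"
      using lu sq d by (intro mult_mono) auto
    then have "exp (- (l * u)) - 2 * d * exp ((\<mu> + 1) * \<bar>u\<bar>) \<le> exp (- (l * u)) * (1 - d * u\<^sup>2)"
      by (simp add: split right_diff_distrib mult.assoc mult.left_commute)
    also have "\<dots> \<le> exp (- (l * u)) * exp (- (d * u\<^sup>2))"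
      using exp_ge_add_one_self[of "- (d * u\<^sup>2)"] by (intro mult_left_mono) auto
    also have "\<dots> = exp (- (l * u) - d * u\<^sup>2)" by (simp add: exp_add[symmetric])
    finally have "\<phi>0 * (exp (- (l * u)) - 2 * d * exp ((\<mu> + 1) * \<bar>u\<bar>)) \<le> y"
      using \<phi>0 touch[OF True] mult_left_mono by (smt (verit))
    then have 1: "a * \<phi>0 * (exp (- (l * u)) - 2 * d * exp ((\<mu> + 1) * \<bar>u\<bar>)) \<le> a * y"
      using a by (simp add: mult.assoc mult_left_mono)
    have "y \<le> \<phi>0 * exp ((\<mu> + 1) * \<bar>u\<bar>)"
      using harnack \<phi>0 ge1 by (meson mult_left_mono less_imp_le order_trans)
    then have 2: "e * y \<le> e * \<phi>0 * exp ((\<mu> + 1) * \<bar>u\<bar>)"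
      using e by (simp add: mult.assoc mult_left_mono)
    show ?thesis using 1 2 f[OF True] by (simp add: algebra_simps)
  next
    case False
    then have "1 \<le> d * \<bar>u\<bar>" using d by (simp add: field_simps)
    also have "\<dots> \<le> d * exp \<bar>u\<bar>" using d exp_ge_add_one_self[of "\<bar>u\<bar>"] by (intro mult_left_mono) linarith+
    finally have "exp (\<mu> * \<bar>u\<bar>) * 1 \<le> exp (\<mu> * \<bar>u\<bar>) * (2 * d * exp \<bar>u\<bar>)"
      by (intro mult_left_mono) auto
    also have "\<dots> = 2 * d * exp ((\<mu> + 1) * \<bar>u\<bar>)" unfolding split by (simp only: mult_ac)
    finally have "exp (\<mu> * \<bar>u\<bar>) \<le> 2 * d * exp ((\<mu> + 1) * \<bar>u\<bar>)" by simp
    moreover have "exp (- (l * u)) \<le> exp (\<mu> * \<bar>u\<bar>)" using lu by simp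
    ultimately have "exp (- (l * u)) - 2 * d * exp ((\<mu> + 1) * \<bar>u\<bar>) \<le> 0" by linarith
    then have "a * \<phi>0 * (exp (- (l * u)) - 2 * d * exp ((\<mu> + 1) * \<bar>u\<bar>)) \<le> 0"
      using a \<phi>0 by (intro mult_nonneg_nonpos) auto
    moreover have "0 \<le> e * \<phi>0 * exp ((\<mu> + 1) * \<bar>u\<bar>)" using e \<phi>0 by simp
    ultimately show ?thesis using f0 by linarith
  qed
qed

section \<open>Profiles\<close>

text \<open>This expresses the derivative \<open>DF\<close> through the partial derivatives
  \<open>DF (1, 0)\<close> and \<open>DF (0, axis j 1)\<close> of \<open>F\<close> at the
  origin.\<close>

lemma linear_prod_vec_expand:
  fixes L :: "real \<times> (real ^ 'm) \<Rightarrow> real"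
  assumes "linear L"
  shows "L (x, v) = x * L (1, 0) + (\<Sum>j\<in>UNIV. v $ j * L (0, axis j 1))"
proof -
  have "(x, v) = x *\<^sub>R (1, 0) + (\<Sum>j\<in>UNIV. (v $ j) *\<^sub>R (0, axis j 1))"
    using basis_expansion[of v] by (simp add: prod_eq_iff fst_sum snd_sum scalar_mult_eq_scaleR)
  then have "L (x, v) = L (x *\<^sub>R (1, 0) + (\<Sum>j\<in>UNIV. (v $ j) *\<^sub>R (0, axis j 1)))"
    by (rule arg_cong)
  then show ?thesis
    unfolding linear_add[OF assms] linear_sum[OF assms] linear_scale[OF assms] by simp
qed

lemma convex_on_sum_fun:
  assumes "\<And>i. i \<in> I \<Longrightarrow> convex_on S (f i)" "convex S"
  shows "convex_on S (\<lambda>x. \<Sum>i\<in>I. f i x :: real)"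
  using assms by (induction I rule: infinite_finite_induct) (auto simp: convex_on_const)

text \<open>The profile equation on the whole line, with an arbitrary continuous shift \<open>g\<close> instead of
  \<open>s \<mapsto> c * h + s\<close>, so that the reflection \<open>t \<mapsto> - t\<close> stays within the class.\<close>

locale profile =
  fixes F DF :: "real \<times> (real ^ 'm) \<Rightarrow> real"
    and f K :: "'m \<Rightarrow> real \<Rightarrow> real"
    and f' :: "'m \<Rightarrow> real"
    and g \<phi> \<phi>1 \<phi>2 :: "real \<Rightarrow> real"
    and c q :: real
  assumes q: "q > 0"
    and F_nonneg: "\<And>v. v \<in> orthant \<Longrightarrow> F v \<ge> 0" and F_0: "F 0 = 0"
    and F_deriv: "(F has_derivative DF) (at 0 within orthant)"
    and DF_0: "DF (1, 0) = 0" and DF_nonneg: "\<And>j. DF (0, axis j 1) \<ge> 0"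
    and f_cont: "\<And>j. continuous_on {0..} (f j)"
    and f_nonneg: "\<And>j s. s \<ge> 0 \<Longrightarrow> f j s \<ge> 0" and f_0: "\<And>j. f j 0 = 0"
    and f_deriv: "\<And>j. (f j has_real_derivative f' j) (at 0 within {0..})"
    and f'_nonneg: "\<And>j. f' j \<ge> 0"
    and K_nonneg: "\<And>j s. K j s \<ge> 0"
    and g_cont: "continuous_on UNIV g"
    and K_int: "\<And>j r. integrable lebesgue (\<lambda>s. K j s * exp (r * g s))"
    and \<phi>_deriv: "\<And>t. (\<phi> has_real_derivative \<phi>1 t) (at t)"
    and \<phi>1_deriv: "\<And>t. (\<phi>1 has_real_derivative \<phi>2 t) (at t)"
    and \<phi>_pos: "\<And>t. 0 < \<phi> t" and \<phi>_bounded: "bounded (range \<phi>)"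
    and eq: "\<And>t. c * \<phi>1 t = \<phi>2 t - q * \<phi> t
        + F (\<phi> t, \<chi> j. LINT s|lebesgue. K j s * f j (\<phi> (t - g s)))"
begin

text \<open>Inserting \<open>exp (l * t)\<close> into the profile equation linearised at zero and
  dividing by \<open>exp (l * t)\<close> leaves this expression.\<close>

definition char_fun :: "real \<Rightarrow> real" where
  "char_fun l = l\<^sup>2 - c * l - q
     + (\<Sum>j\<in>UNIV. DF (0, axis j 1) * f' j * (LINT s|lebesgue. K j s * exp (- (l * g s))))"

lemma convex_on_char_fun: "convex_on UNIV char_fun"
proof -
  have "convex_on UNIV (\<lambda>l. l\<^sup>2 - c * l - q)"
    by (rule convex_on_realI[where f' = "\<lambda>l. 2 * l - c"]) (auto intro!: derivative_eq_intros)
  moreover have "convex_on UNIV (\<lambda>l. \<Sum>j\<in>UNIV. DF (0, axis j 1) * f' j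
      * (LINT s|lebesgue. K j s * exp (- (l * g s))))"
    by (intro convex_on_sum_fun convex_on_cmul convex_on_laplace_transform K_nonneg K_int
        mult_nonneg_nonneg DF_nonneg f'_nonneg) auto
  ultimately show ?thesis
    unfolding char_fun_def[abs_def] by (rule convex_on_add)
qed

lemma continuous_on_char_fun: "continuous_on A char_fun"
  using convex_on_continuous[OF open_UNIV convex_on_char_fun] continuous_on_subset by blast

text \<open>Compactness turns pointwise positivity into a uniform margin; the interval will be the
  range of possible touching slopes.\<close>

lemma char_fun_pos_lower_bound:
  assumes "\<And>l. 0 \<le> l \<Longrightarrow> 0 < char_fun l" "0 \<le> b"
  obtains k where "0 < k" "\<And>l. 0 \<le> l \<Longrightarrow> l \<le> b \<Longrightarrow> k \<le> char_fun l"
proof -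
  obtain x where "x \<in> {0..b}" "\<forall>y\<in>{0..b}. char_fun x \<le> char_fun y"
    using continuous_attains_inf[of "{0..b}" char_fun] assms(2) continuous_on_char_fun by auto
  then show ?thesis using assms(1)[of x] that[of "char_fun x"] by auto
qed

section \<open>A priori bounds for the profile\<close>

definition exp_moment :: "real \<Rightarrow> real" where
  "exp_moment r = (\<Sum>j\<in>UNIV. LINT s|lebesgue. K j s * exp (r * \<bar>g s\<bar>))"

lemma integrable_exp_moment: "integrable lebesgue (\<lambda>s. K j s * exp (r * \<bar>g s\<bar>))"
  by (rule integrable_exp_abs[OF K_nonneg g_cont K_int])

lemma exp_moment_upper: "(LINT s|lebesgue. K j s * exp (r * \<bar>g s\<bar>)) \<le> exp_moment r"
  unfolding exp_moment_def by (rule member_le_sum) (auto intro!: Bochner_Integration.integral_nonneg mult_nonneg_nonneg K_nonneg)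

lemma exp_moment_nonneg: "0 \<le> exp_moment r"
  unfolding exp_moment_def by (auto intro!: sum_nonneg Bochner_Integration.integral_nonneg mult_nonneg_nonneg K_nonneg)

text \<open>Dropping the nonnegative term \<open>F\<close> leaves a differential inequality that
  bounds \<open>\<phi>1 / \<phi>\<close>. The Lipschitz bound on \<open>ln \<phi>\<close> acts as a
  Harnack inequality: it compares values of \<open>\<phi>\<close> at any two points.\<close>

lemma \<phi>_harnack:
  obtains \<mu> where "0 < \<mu>" "\<And>t. \<bar>\<phi>1 t\<bar> \<le> \<mu> * \<phi> t" "\<And>s t. \<bar>ln (\<phi> t) - ln (\<phi> s)\<bar> \<le> \<mu> * \<bar>t - s\<bar>"
proof -
  have "\<phi>2 t \<le> c * \<phi>1 t + q * \<phi> t" for t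
  proof -
    have "(\<phi> t, \<chi> j. LINT s|lebesgue. K j s * f j (\<phi> (t - g s))) \<in> orthant"
      using \<phi>_pos by (auto simp: orthant_def less_imp_le
          intro!: Bochner_Integration.integral_nonneg mult_nonneg_nonneg K_nonneg f_nonneg)
    then show ?thesis using F_nonneg eq[of t] by fastforce
  qed
  from supersolution_log_deriv_bounded[OF \<phi>_pos \<phi>_deriv \<phi>1_deriv q this]
  obtain \<mu> where \<mu>: "0 < \<mu>" "\<And>t. \<bar>\<phi>1 t\<bar> \<le> \<mu> * \<phi> t" by blast
  have der: "((\<lambda>t. ln (\<phi> t)) has_real_derivative \<phi>1 t / \<phi> t) (at t within UNIV)" for t
    using \<phi>_pos[of t] by (auto intro!: derivative_eq_intros \<phi>_deriv simp: field_simps)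
  have "\<bar>ln (\<phi> t) - ln (\<phi> s)\<bar> \<le> \<mu> * \<bar>t - s\<bar>" for s t
  proof -
    have "norm (\<phi>1 x / \<phi> x) \<le> \<mu>" for x
      using \<mu>(2)[of x] \<phi>_pos[of x] by (simp add: divide_le_eq)
    then show ?thesis
      using field_differentiable_bound[of UNIV "\<lambda>t. ln (\<phi> t)" "\<lambda>t. \<phi>1 t / \<phi> t" \<mu> t s] der by auto
  qed
  with \<mu> show ?thesis using that by blast
qed

text \<open>A bounded profile sees each \<open>f j\<close> only on a compact interval. The bound
  makes the nonlocal arguments of \<open>F\<close> small whenever \<open>\<phi>\<close> is small at
  the touching point.\<close>

lemma f_linear_bound:
  obtains C where "0 \<le> C" "\<And>j t. f j (\<phi> t) \<le> C * \<phi> t"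
proof -
  obtain M where M: "\<And>t. \<phi> t \<le> M"
    using \<phi>_bounded unfolding bounded_iff by (metis abs_le_D1 rangeI real_norm_def)
  have "\<exists>C. 0 \<le> C \<and> (\<forall>x. 0 \<le> x \<longrightarrow> x \<le> M \<longrightarrow> f j x \<le> C * x)" for j
    using linear_bound_of_deriv_at_0[OF f_cont f_deriv f_0] by metis
  then obtain C where C: "\<And>j. 0 \<le> C j" "\<And>j x. 0 \<le> x \<Longrightarrow> x \<le> M \<Longrightarrow> f j x \<le> C j * x"
    by metis
  show ?thesis
  proof
    show "0 \<le> sum C UNIV" using C(1) by (simp add: sum_nonneg)
    fix j t
    have "f j (\<phi> t) \<le> C j * \<phi> t" using C(2) M \<phi>_pos less_imp_le by blast
    also have "\<dots> \<le> sum C UNIV * \<phi> t"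
      using C(1) \<phi>_pos[of t] by (intro mult_right_mono member_le_sum) auto
    finally show "f j (\<phi> t) \<le> sum C UNIV * \<phi> t" .
  qed
qed

section \<open>Persistence at both ends and absence of pulses\<close>

lemma liminf_at_left_pos:
  assumes char: "\<And>l. 0 \<le> l \<Longrightarrow> 0 < char_fun l"
  shows "\<exists>e>0. \<exists>T. \<forall>t\<le>T. e \<le> \<phi> t"
proof (rule ccontr)
  assume neg: "\<not> ?thesis"
  obtain \<mu> where \<mu>: "0 < \<mu>" "\<And>t. \<bar>\<phi>1 t\<bar> \<le> \<mu> * \<phi> t"
    and lip: "\<And>s t. \<bar>ln (\<phi> t) - ln (\<phi> s)\<bar> \<le> \<mu> * \<bar>t - s\<bar>"
    using \<phi>_harnack by blast
  have harnack: "\<phi> t \<le> \<phi> s * exp (\<mu> * \<bar>t - s\<bar>)" for s t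
  proof -
    have "ln (\<phi> t) \<le> ln (\<phi> s * exp (\<mu> * \<bar>t - s\<bar>))"
      using lip[of t s] \<phi>_pos[of s] by (simp add: ln_mult)
    then show ?thesis using \<phi>_pos by simp
  qed
  obtain C where C: "0 \<le> C" "\<And>j t. f j (\<phi> t) \<le> C * \<phi> t"
    using f_linear_bound by blast
  obtain k where k: "0 < k" "\<And>l. 0 \<le> l \<Longrightarrow> l \<le> \<mu> \<Longrightarrow> k \<le> char_fun l"
    using char_fun_pos_lower_bound[OF char, of \<mu>] \<mu> by auto
  \<comment> \<open>\<open>V\<close> bounds the weighted moment of every kernel at once, with the
    exponent occurring in the error terms.\<close>
  define V where "V = exp_moment (\<mu> + 1)"
  define D where "D = (\<Sum>j\<in>UNIV. DF (0, axis j 1))"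
  define A where "A = (\<Sum>j\<in>UNIV. DF (0, axis j 1) * f' j)"
  \<comment> \<open>\<open>B\<close> times the touching value will bound the norm of the argument of
    \<open>F\<close>: \<open>1\<close> for the local coordinate, \<open>C * V\<close> for each
    nonlocal one.\<close>
  define B where "B = 1 + real CARD('m) * (C * V)"
  have nn: "0 \<le> V" "0 \<le> D" "0 \<le> A" "1 \<le> B"
    using exp_moment_nonneg DF_nonneg f'_nonneg C
    by (auto simp: V_def D_def A_def B_def intro!: sum_nonneg)
  \<comment> \<open>The curvature will cost \<open>2 * d * (1 + V * A)\<close>, linearising
    \<open>F\<close> costs \<open>e1 * B\<close>, and linearising the \<open>f j\<close> costs
    \<open>e2 * V * D\<close>. These choices hold the three errors to \<open>k / 2\<close>,
    \<open>k / 8\<close> and \<open>k / 8\<close>, leaving part of the margin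
    \<open>k\<close>.\<close>
  define d where "d = k / (4 * (1 + V * A))"
  define e1 where "e1 = k / (8 * B)"
  define e2 where "e2 = k / (8 * (1 + V * D))"
  have VA: "0 < 1 + V * A" "0 < 1 + V * D"
    using nn by (auto intro!: add_pos_nonneg)
  have pos: "0 < d" "0 < e1" "0 < e2"
    using k nn VA by (auto simp: d_def e1_def e2_def)
  obtain \<rho> where \<rho>: "0 < \<rho>" "\<And>v. v \<in> orthant \<Longrightarrow> norm v < \<rho> \<Longrightarrow> DF v - e1 * norm v \<le> F v"
    using has_derivative_at_0_lower[OF F_deriv F_0 pos(2)] by blast
  have "\<exists>r>0. \<forall>x. 0 \<le> x \<longrightarrow> x < r \<longrightarrow> (f' j - e2) * x \<le> f j x" for j
    using deriv_at_0_lower[OF f_deriv f_0 pos(3)] by metis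
  then obtain r where r: "\<And>j. 0 < r j" "\<And>j x. 0 \<le> x \<Longrightarrow> x < r j \<Longrightarrow> (f' j - e2) * x \<le> f j x"
    by metis
  define \<eta> where "\<eta> = Min (range r)"
  have \<eta>: "0 < \<eta>" "\<And>j. \<eta> \<le> r j" using r(1) by (auto simp: \<eta>_def)
  \<comment> \<open>The first bound keeps \<open>\<phi>\<close> below \<open>\<eta>\<close> within
    distance \<open>1 / d\<close> of the touching point, after the Harnack factor
    \<open>exp (\<mu> / d)\<close>; the second puts the argument of \<open>F\<close> inside the ball
    of radius \<open>\<rho>\<close>.\<close>
  define N where "N = min (ln (\<eta> / 2) - \<mu> / d) (ln (\<rho> / 2 / B))"
  have low: "\<exists>s\<le>T. ln (\<phi> s) \<le> N'" for N' T
  proof -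
    obtain s where "s \<le> T" "\<phi> s < exp N'" using neg exp_gt_zero not_le by metis
    moreover from this have "ln (\<phi> s) < N'" using \<phi>_pos[of s] by (metis exp_less_cancel_iff exp_ln)
    ultimately show ?thesis by force
  qed
  \<comment> \<open>Touching must extend to the right by \<open>1 / d\<close> as well, since
    \<open>t0 - g s\<close> exceeds \<open>t0\<close> where \<open>g s\<close> is negative.\<close>
  have R: "0 < 1 / d" using pos(1) by simp
  obtain t0 l where t0: "ln (\<phi> t0) \<le> N" "0 \<le> l"
    and touch: "\<And>t. t \<le> t0 + 1 / d \<Longrightarrow> ln (\<phi> t0) + l * (t - t0) - d * (t - t0)\<^sup>2 \<le> ln (\<phi> t)"
    using lower_parabola_touching[of "\<lambda>t. ln (\<phi> t)", OF lip \<mu>(1) pos(1) R low] by blast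
  define \<phi>0 where "\<phi>0 = \<phi> t0"
  have \<phi>0: "0 < \<phi>0" by (simp add: \<phi>0_def \<phi>_pos)
  have touch': "\<phi>0 * exp (l * (t - t0) - d * (t - t0)\<^sup>2) \<le> \<phi> t" if "\<bar>t - t0\<bar> \<le> 1 / d" for t
  proof -
    have "exp (ln \<phi>0 + (l * (t - t0) - d * (t - t0)\<^sup>2)) \<le> exp (ln (\<phi> t))"
      using touch[of t] that unfolding \<phi>0_def exp_le_cancel_iff by linarith
    then show ?thesis using \<phi>0 \<phi>_pos by (simp only: exp_add exp_ln)
  qed
  have \<phi>12: "\<phi>1 t0 = l * \<phi>0" "(l\<^sup>2 - 2 * d) * \<phi>0 \<le> \<phi>2 t0"
    using lower_gaussian_touching_derivs[OF \<phi>_deriv \<phi>1_deriv, of "1 / d" t0 l d] pos(1) touch'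
    unfolding \<phi>0_def by auto
  have l\<mu>: "l \<le> \<mu>" using \<mu>(2)[of t0] \<phi>12(1) \<phi>0 t0(2) by (simp add: \<phi>0_def abs_mult)
  define I where "I j = (LINT s|lebesgue. K j s * f j (\<phi> (t0 - g s)))" for j
  define E where "E j = (LINT s|lebesgue. K j s * exp ((\<mu> + 1) * \<bar>g s\<bar>))" for j
  define L where "L j = (LINT s|lebesgue. K j s * exp (- (l * g s)))" for j
  have E: "0 \<le> E j" "E j \<le> V" for j
    using exp_moment_upper by (auto simp: E_def V_def intro!: Bochner_Integration.integral_nonneg mult_nonneg_nonneg K_nonneg)
  have f_up: "f j (\<phi> (t0 - g s)) \<le> C * \<phi>0 * exp ((\<mu> + 1) * \<bar>g s\<bar>)" for j s
  proof -
    have "f j (\<phi> (t0 - g s)) \<le> C * \<phi> (t0 - g s)" by (rule C)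
    also have "\<dots> \<le> C * (\<phi>0 * exp (\<mu> * \<bar>g s\<bar>))"
      using harnack[of "t0 - g s" t0] C(1) by (intro mult_left_mono) (auto simp: \<phi>0_def)
    also have "\<dots> \<le> C * (\<phi>0 * exp ((\<mu> + 1) * \<bar>g s\<bar>))"
      using C(1) \<phi>0 by (intro mult_left_mono) (auto simp: mult_right_mono)
    finally show ?thesis by (simp add: mult.assoc)
  qed
  have f_int: "integrable lebesgue (\<lambda>s. K j s * f j (\<phi> (t0 - g s)))" for j
  proof (rule Bochner_Integration.integrable_bound)
    show "integrable lebesgue (\<lambda>s. C * \<phi>0 * (K j s * exp ((\<mu> + 1) * \<bar>g s\<bar>)))"
      by (intro integrable_mult_right integrable_exp_moment)
    have 1: "K j \<in> borel_measurable lebesgue"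
      using borel_measurable_integrable[OF K_int[of j 0]] by simp
    have "continuous_on UNIV \<phi>"
      using \<phi>_deriv by (meson DERIV_continuous continuous_at_imp_continuous_on)
    then have "continuous_on UNIV (\<lambda>s. \<phi> (t0 - g s))"
      by (rule continuous_on_compose2) (auto intro!: continuous_intros g_cont)
    then have "continuous_on UNIV (\<lambda>s. f j (\<phi> (t0 - g s)))"
      using \<phi>_pos less_imp_le by (intro continuous_on_compose2[OF f_cont]) auto
    from borel_measurable_continuous_onI[OF this]
    have "(\<lambda>s. f j (\<phi> (t0 - g s))) \<in> borel_measurable lebesgue" by (simp add: measurable_completion)
    with 1 show "(\<lambda>s. K j s * f j (\<phi> (t0 - g s))) \<in> borel_measurable lebesgue" by measurable
    have "\<bar>K j s * f j (\<phi> (t0 - g s))\<bar> \<le> \<bar>C * \<phi>0 * (K j s * exp ((\<mu> + 1) * \<bar>g s\<bar>))\<bar>" for s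
    proof -
      have "0 \<le> K j s * f j (\<phi> (t0 - g s))"
        by (intro mult_nonneg_nonneg K_nonneg f_nonneg less_imp_le[OF \<phi>_pos])
      moreover have "K j s * f j (\<phi> (t0 - g s)) \<le> C * \<phi>0 * (K j s * exp ((\<mu> + 1) * \<bar>g s\<bar>))"
        using mult_left_mono[OF f_up[of j s] K_nonneg[of j s]] by (simp add: mult_ac)
      ultimately show ?thesis by linarith
    qed
    then show "AE s in lebesgue. norm (K j s * f j (\<phi> (t0 - g s)))
        \<le> norm (C * \<phi>0 * (K j s * exp ((\<mu> + 1) * \<bar>g s\<bar>)))" by simp
  qed
  have I0: "0 \<le> I j" for j
    unfolding I_def using \<phi>_pos less_imp_le by (auto intro!: Bochner_Integration.integral_nonneg mult_nonneg_nonneg K_nonneg f_nonneg)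
  have I_up: "I j \<le> C * \<phi>0 * V" for j
  proof -
    have "I j \<le> (LINT s|lebesgue. C * \<phi>0 * (K j s * exp ((\<mu> + 1) * \<bar>g s\<bar>)))"
      unfolding I_def
    proof (intro integral_mono f_int integrable_mult_right integrable_exp_moment)
      show "K j s * f j (\<phi> (t0 - g s)) \<le> C * \<phi>0 * (K j s * exp ((\<mu> + 1) * \<bar>g s\<bar>))" for s
        using mult_left_mono[OF f_up[of j s] K_nonneg[of j s]] by (simp add: mult_ac)
    qed
    also have "\<dots> = C * \<phi>0 * E j" by (simp add: E_def)
    also have "\<dots> \<le> C * \<phi>0 * V" using E C(1) \<phi>0 by (intro mult_left_mono) auto
    finally show ?thesis .
  qed
  have \<phi>0_small: "\<phi>0 * exp (\<mu> / d) < \<eta>" "\<phi>0 * B < \<rho>"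
  proof -
    have "ln \<phi>0 + \<mu> / d \<le> ln (\<eta> / 2)" using t0(1) by (simp add: N_def \<phi>0_def)
    then have "exp (ln \<phi>0 + \<mu> / d) \<le> exp (ln (\<eta> / 2))" by simp
    then show "\<phi>0 * exp (\<mu> / d) < \<eta>" using \<phi>0 \<eta>(1) by (simp add: exp_add)
    have "ln \<phi>0 \<le> ln (\<rho> / 2 / B)" using t0(1) by (simp add: N_def \<phi>0_def)
    then have "\<phi>0 \<le> \<rho> / 2 / B" using \<phi>0 \<rho>(1) nn(4) by simp
    then show "\<phi>0 * B < \<rho>" using \<rho>(1) nn(4) by (simp add: field_simps)
  qed
  have I_low: "f' j * \<phi>0 * (L j - 2 * d * V) - e2 * \<phi>0 * V \<le> I j" for j
  proof -
    have pw: "f' j * \<phi>0 * (exp (- (l * g s)) - 2 * d * exp ((\<mu> + 1) * \<bar>g s\<bar>))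
        - e2 * \<phi>0 * exp ((\<mu> + 1) * \<bar>g s\<bar>) \<le> f j (\<phi> (t0 - g s))" for s
    proof (rule nonlinear_kernel_lower_bound[where f = "f j" and u = "g s" and y = "\<phi> (t0 - g s)" and \<mu> = \<mu> and l = l and d = d])
      show "\<phi> (t0 - g s) \<le> \<phi>0 * exp (\<mu> * \<bar>g s\<bar>)"
        using harnack[of "t0 - g s" t0] by (simp add: \<phi>0_def)
      assume s: "\<bar>g s\<bar> \<le> 1 / d"
      show "\<phi>0 * exp (- (l * g s) - d * (g s)\<^sup>2) \<le> \<phi> (t0 - g s)"
        using touch'[of "t0 - g s"] s by simp
      have "\<phi> (t0 - g s) \<le> \<phi>0 * exp (\<mu> * \<bar>g s\<bar>)"
        using harnack[of "t0 - g s" t0] by (simp add: \<phi>0_def)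
      also have "\<dots> \<le> \<phi>0 * exp (\<mu> * (1 / d))"
        using \<phi>0 mult_left_mono[OF s, of \<mu>] \<mu>(1) by (intro mult_left_mono) auto
      also have "\<dots> < r j" using \<phi>0_small(1) \<eta>(2)[of j] by simp
      finally show "(f' j - e2) * \<phi> (t0 - g s) \<le> f j (\<phi> (t0 - g s))"
        using r(2) \<phi>_pos less_imp_le by blast
    qed (use pos \<phi>0 \<phi>_pos f'_nonneg l\<mu> t0(2) f_nonneg[OF less_imp_le[OF \<phi>_pos]] in auto)
    have i: "integrable lebesgue (\<lambda>s. K j s * exp (- (l * g s)))"
      using K_int[of j "- l"] by simp
    \<comment> \<open>Replacing \<open>E j\<close> by its bound \<open>V\<close> only lowers the
      expression, as its coefficients there are nonpositive.\<close>
    have "f' j * \<phi>0 * (L j - 2 * d * V) - e2 * \<phi>0 * V \<le> f' j * \<phi>0 * (L j - 2 * d * E j) - e2 * \<phi>0 * E j"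
      using E \<phi>0 pos f'_nonneg[of j] by (intro diff_mono mult_left_mono) auto
    also have "\<dots> = (LINT s|lebesgue. f' j * \<phi>0 * (K j s * exp (- (l * g s)) - 2 * d * (K j s * exp ((\<mu> + 1) * \<bar>g s\<bar>)))
        - e2 * \<phi>0 * (K j s * exp ((\<mu> + 1) * \<bar>g s\<bar>)))"
      using i integrable_exp_moment[of j "\<mu> + 1"] by (simp add: L_def E_def)
    also have "\<dots> \<le> I j"
      unfolding I_def
    proof (intro integral_mono f_int Bochner_Integration.integrable_diff integrable_mult_right integrable_exp_moment i)
      fix s
      show "f' j * \<phi>0 * (K j s * exp (- (l * g s)) - 2 * d * (K j s * exp ((\<mu> + 1) * \<bar>g s\<bar>)))
        - e2 * \<phi>0 * (K j s * exp ((\<mu> + 1) * \<bar>g s\<bar>)) \<le> K j s * f j (\<phi> (t0 - g s))"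
        using mult_left_mono[OF pw[of s] K_nonneg[of j s]] by (simp add: algebra_simps)
    qed
    finally show ?thesis .
  qed
  define v where "v = (\<phi>0, \<chi> j. I j)"
  have v: "v \<in> orthant" using \<phi>0 I0 by (simp add: v_def orthant_def)
  have norm_v: "norm v \<le> \<phi>0 * B"
  proof -
    have "norm v \<le> \<bar>\<phi>0\<bar> + norm (\<chi> j. I j)"
      unfolding v_def using norm_Pair_le by (metis real_norm_def)
    also have "norm (\<chi> j. I j) \<le> (\<Sum>j\<in>UNIV. \<bar>I j\<bar>)"
      using norm_le_l1_cart[of "\<chi> j. I j"] by simp
    also have "\<dots> \<le> (\<Sum>j\<in>(UNIV :: 'm set). C * \<phi>0 * V)"
      using I0 I_up by (intro sum_mono) simp
    finally show ?thesis using \<phi>0 by (simp add: B_def algebra_simps)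
  qed
  have lin: "DF v = (\<Sum>j\<in>UNIV. DF (0, axis j 1) * I j)"
    unfolding v_def using linear_prod_vec_expand[OF has_derivative_linear[OF F_deriv], of \<phi>0 "\<chi> j. I j"] DF_0
    by (simp add: mult.commute)
  have "(\<Sum>j\<in>UNIV. DF (0, axis j 1) * (f' j * \<phi>0 * (L j - 2 * d * V) - e2 * \<phi>0 * V)) \<le> DF v"
    unfolding lin by (intro sum_mono mult_left_mono I_low DF_nonneg)
  also have "(\<Sum>j\<in>UNIV. DF (0, axis j 1) * (f' j * \<phi>0 * (L j - 2 * d * V) - e2 * \<phi>0 * V))
      = \<phi>0 * ((\<Sum>j\<in>UNIV. DF (0, axis j 1) * f' j * L j) - 2 * d * V * A - e2 * V * D)"
    by (simp add: A_def D_def sum_distrib_left sum_subtractf sum.distrib algebra_simps)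
  finally have DFv: "\<phi>0 * ((\<Sum>j\<in>UNIV. DF (0, axis j 1) * f' j * L j) - 2 * d * V * A - e2 * V * D) \<le> DF v" .
  have Fv: "DF v - e1 * (\<phi>0 * B) \<le> F v"
    using \<rho>(2)[OF v] norm_v \<phi>0_small(2) pos(2) mult_left_mono[OF norm_v, of e1] by linarith
  have eq0: "c * (l * \<phi>0) = \<phi>2 t0 - q * \<phi>0 + F v"
    using eq[of t0] \<phi>12(1) by (simp add: v_def I_def[abs_def] \<phi>0_def)
  \<comment> \<open>Lower bounds for \<open>\<phi>2 t0\<close>, \<open>DF v\<close> and
    \<open>F v\<close> turn the equation at \<open>t0\<close> into an inequality in which every term
    carries the positive factor \<open>\<phi>0\<close>.\<close>
  have "\<phi>0 * (char_fun l - 2 * d - 2 * d * V * A - e2 * V * D - e1 * B) \<le> 0"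
    using eq0 \<phi>12(2) DFv Fv by (simp add: char_fun_def L_def algebra_simps)
  then have "char_fun l - 2 * d - 2 * d * V * A - e2 * V * D - e1 * B \<le> 0"
    using \<phi>0 by (simp only: mult_le_0_iff) linarith
  then have le: "char_fun l \<le> 2 * (d * (1 + V * A)) + e2 * V * D + e1 * B"
    by (simp add: algebra_simps)
  have cancel: "k / (n * x) * x = k / n" if "0 < x" for n x :: real
    using that by simp
  have "d * (1 + V * A) = k / 4" unfolding d_def by (rule cancel[OF VA(1)])
  moreover have "e1 * B = k / 8" unfolding e1_def by (rule cancel) (use nn in simp)
  moreover have "e2 * V * D \<le> k / 8"
  proof -
    have "e2 * (V * D) \<le> e2 * (1 + V * D)" using pos by (intro mult_left_mono) auto
    also have "\<dots> = k / 8" unfolding e2_def by (rule cancel[OF VA(2)])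
    finally show ?thesis by (simp add: mult.assoc)
  qed
  ultimately have "char_fun l \<le> 3 / 4 * k" using le by linarith
  then show False using k(2)[OF t0(2) l\<mu>] k(1) by simp
qed

lemma profile_reflect:
  "profile F DF f K f' (\<lambda>s. - g s) (\<lambda>t. \<phi> (- t)) (\<lambda>t. - \<phi>1 (- t)) (\<lambda>t. \<phi>2 (- t)) (- c) q"
proof
  show "((\<lambda>t. \<phi> (- t)) has_real_derivative - \<phi>1 (- t)) (at t)" for t
    using \<phi>_deriv[of "- t"] by (simp add: DERIV_mirror)
  show "((\<lambda>t. - \<phi>1 (- t)) has_real_derivative \<phi>2 (- t)) (at t)" for t
    using DERIV_minus[of "\<lambda>t. \<phi>1 (- t)" "- \<phi>2 (- t)"] \<phi>1_deriv[of "- t"] by (simp add: DERIV_mirror)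
  show "integrable lebesgue (\<lambda>s. K j s * exp (r * - g s))" for j r
    using K_int[of j "- r"] by simp
  show "bounded (range (\<lambda>t. \<phi> (- t)))"
    using \<phi>_bounded by (rule bounded_subset) auto
  show "- c * - \<phi>1 (- t) = \<phi>2 (- t) - q * \<phi> (- t)
      + F (\<phi> (- t), \<chi> j. LINT s|lebesgue. K j s * f j (\<phi> (- (t - - g s))))" for t
    using eq[of "- t"] by simp
qed (use q F_nonneg F_0 F_deriv DF_0 DF_nonneg f_cont f_nonneg f_0 f_deriv f'_nonneg K_nonneg
    \<phi>_pos in \<open>auto intro!: continuous_intros g_cont\<close>)

text \<open>The reflected profile has characteristic function \<open>char_fun (- l)\<close>, so the
  result at minus infinity applies to it.\<close>

lemma liminf_at_right_pos:
  assumes char: "\<And>l. l \<le> 0 \<Longrightarrow> 0 < char_fun l"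
  shows "\<exists>e>0. \<exists>T. \<forall>t\<ge>T. e \<le> \<phi> t"
proof -
  interpret r: profile F DF f K f' "\<lambda>s. - g s" "\<lambda>t. \<phi> (- t)" "\<lambda>t. - \<phi>1 (- t)" "\<lambda>t. \<phi>2 (- t)" "- c" q
    by (rule profile_reflect)
  have "r.char_fun l = char_fun (- l)" for l
    by (simp add: r.char_fun_def char_fun_def)
  then obtain e T where e: "e > 0" "\<And>t. t \<le> T \<Longrightarrow> e \<le> \<phi> (- t)"
    using r.liminf_at_left_pos char by auto
  then have "\<forall>t\<ge>- T. e \<le> \<phi> t" using e(2)[of "- t" for t] by (metis minus_le_iff minus_minus)
  with e(1) show ?thesis by blast
qed

text \<open>Decay at each end yields a point of the corresponding closed half-line where
  \<open>char_fun\<close> is nonpositive, and convexity carries this to zero. The argument is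
  insensitive to the sign of \<open>c\<close>, so negative speeds are covered.\<close>

lemma not_pulse:
  assumes "0 < char_fun 0" "(\<phi> \<longlongrightarrow> 0) at_bot" "(\<phi> \<longlongrightarrow> 0) at_top"
  shows False
proof -
  have "\<exists>a\<ge>0. char_fun a \<le> 0"
  proof (rule ccontr)
    assume "\<not> ?thesis"
    then have "\<exists>e>0. \<exists>T. \<forall>t\<le>T. e \<le> \<phi> t" by (intro liminf_at_left_pos) force
    then obtain e T where e: "e > 0" "\<And>t. t \<le> T \<Longrightarrow> e \<le> \<phi> t" by blast
    have "eventually (\<lambda>t. \<phi> t < e \<and> t \<le> T) at_bot"
      using order_tendstoD(2)[OF assms(2) e(1)] eventually_le_at_bot by (rule eventually_conj)
    then obtain t where "\<phi> t < e" "t \<le> T" using eventually_happens' trivial_limit_at_bot_linorder by blast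
    then show False using e(2)[of t] by simp
  qed
  then obtain a where a: "0 \<le> a" "char_fun a \<le> 0" by blast
  have "\<exists>b\<le>0. char_fun b \<le> 0"
  proof (rule ccontr)
    assume "\<not> ?thesis"
    then have "\<exists>e>0. \<exists>T. \<forall>t\<ge>T. e \<le> \<phi> t" by (intro liminf_at_right_pos) force
    then obtain e T where e: "e > 0" "\<And>t. T \<le> t \<Longrightarrow> e \<le> \<phi> t" by blast
    have "eventually (\<lambda>t. \<phi> t < e \<and> T \<le> t) at_top"
      using order_tendstoD(2)[OF assms(3) e(1)] eventually_ge_at_top by (rule eventually_conj)
    then obtain t where "\<phi> t < e" "T \<le> t" using eventually_happens' trivial_limit_at_top_linorder by blast
    then show False using e(2)[of t] by simp
  qed
  then obtain b where b: "b \<le> 0" "char_fun b \<le> 0" by blast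
  show False
  proof (cases "a = 0 \<or> b = 0")
    case False
    then have "(a - b) * char_fun 0 \<le> (a - 0) * char_fun b + (0 - b) * char_fun a"
      using a b by (intro convex_on_real_chord[OF convex_on_char_fun]) auto
    also have "\<dots> \<le> 0" using a b by (intro add_nonpos_nonpos mult_nonneg_nonpos) auto
    finally show False using assms(1) False a b by (simp add: mult_le_0_iff)
  qed (use a b assms(1) in auto)
qed

end

section \<open>The critical pair\<close>

text \<open>This is \<open>psi\<close> in the variables \<open>l = sqrt \<epsilon> * z\<close> and
  \<open>c = 1 / sqrt \<epsilon>\<close>. Here the kernel integral is free of the parameter, which
  makes the dependence on \<open>c\<close> monotone for each sign of \<open>l\<close>.\<close>

definition chi :: "real \<Rightarrow> real \<Rightarrow> real \<Rightarrow> (real \<Rightarrow> real) \<Rightarrow> real \<Rightarrow> real \<Rightarrow> real" where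
  "chi h p q K c l = l\<^sup>2 - c * l - q + p * exp (- (l * (c * h))) * (LINT s|lebesgue. K s * exp (- (l * s)))"

lemma psi_eq_chi:
  assumes "0 < \<epsilon>"
  shows "psi h p q K z \<epsilon> = chi h p q K (1 / sqrt \<epsilon>) (sqrt \<epsilon> * z)"
  using assms by (simp add: psi_def chi_def power_mult_distrib)

lemma psi_zeros_eq_chi_zeros:
  assumes "0 < \<epsilon>"
  shows "{z. psi h p q K z \<epsilon> = 0} = (\<lambda>l. l / sqrt \<epsilon>) ` {l. chi h p q K (1 / sqrt \<epsilon>) l = 0}"
proof (intro equalityI subsetI)
  fix z assume "z \<in> {z. psi h p q K z \<epsilon> = 0}"
  then show "z \<in> (\<lambda>l. l / sqrt \<epsilon>) ` {l. chi h p q K (1 / sqrt \<epsilon>) l = 0}"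
    using assms by (intro image_eqI[of _ _ "sqrt \<epsilon> * z"]) (auto simp: psi_eq_chi)
next
  fix z assume "z \<in> (\<lambda>l. l / sqrt \<epsilon>) ` {l. chi h p q K (1 / sqrt \<epsilon>) l = 0}"
  then obtain l where "z = l / sqrt \<epsilon>" "chi h p q K (1 / sqrt \<epsilon>) l = 0" by blast
  then show "z \<in> {z. psi h p q K z \<epsilon> = 0}" using assms by (simp add: psi_eq_chi)
qed

lemma card_psi_zeros:
  assumes "0 < \<epsilon>"
  shows "card {z. psi h p q K z \<epsilon> = 0} = card {l. chi h p q K (1 / sqrt \<epsilon>) l = 0}"
  using assms unfolding psi_zeros_eq_chi_zeros[OF assms] by (intro card_image inj_onI) simp

section \<open>Uniqueness of the critical pair\<close>

lemma critical_pairD: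
  assumes "critical_pair h p q K a b"
  shows "0 < a" "a \<le> b"
    and "0 < ereal \<epsilon> \<Longrightarrow> ereal \<epsilon> < a \<Longrightarrow> card {z. psi h p q K z \<epsilon> = 0} = 2"
    and "0 < ereal \<epsilon> \<Longrightarrow> ereal \<epsilon> < a \<Longrightarrow> psi h p q K z \<epsilon> = 0 \<Longrightarrow> 0 < z"
    and "a < ereal \<epsilon> \<Longrightarrow> ereal \<epsilon> < b \<Longrightarrow> 0 < psi h p q K z \<epsilon>"
    and "b < ereal \<epsilon> \<Longrightarrow> card {z. psi h p q K z \<epsilon> = 0} = 2"
    and "b < ereal \<epsilon> \<Longrightarrow> psi h p q K z \<epsilon> = 0 \<Longrightarrow> z < 0"
  using assms by (simp_all add: critical_pair_def)

text \<open>If two pairs differed, some \<epsilon> would fall into different regimes for them, and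
  the regimes (positive roots, no roots, negative roots) exclude one another.\<close>

lemma critical_pair_unique:
  assumes P: "critical_pair h p q K a b" and P': "critical_pair h p q K a' b'"
  shows "a = a' \<and> b = b'"
proof -
  have fst_le: "a2 \<le> a1" if P1: "critical_pair h p q K a1 b1" and P2: "critical_pair h p q K a2 b2" for a1 b1 a2 b2
  proof (rule ccontr)
    assume "\<not> ?thesis"
    then have lt: "a1 < a2" by simp
    have "0 < a1" "a1 \<le> b1" using critical_pairD(1,2)[OF P1] .
    \<comment> \<open>If the first pair has a gap, \<epsilon> is kept inside it, where there are no
      roots; otherwise \<epsilon> lies beyond \<open>b1\<close>, where all roots are
      negative.\<close>
    define m where "m = (if a1 < b1 then min a2 b1 else a2)"
    have "a1 < m" using lt by (auto simp: m_def)
    then obtain \<epsilon> :: real where \<epsilon>: "a1 < ereal \<epsilon>" "ereal \<epsilon> < m" using ereal_dense2 by blast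
    have \<epsilon>0: "0 < ereal \<epsilon>" using less_trans[OF \<open>0 < a1\<close> \<epsilon>(1)] .
    have "ereal \<epsilon> < a2" using \<epsilon>(2) by (auto simp: m_def split: if_splits)
    note two = critical_pairD(3,4)[OF P2 \<epsilon>0 this]
    from two(1) have "{z. psi h p q K z \<epsilon> = 0} \<noteq> {}" by (intro notI) simp
    then obtain z where z: "psi h p q K z \<epsilon> = 0" by blast
    show False
    proof (cases "a1 < b1")
      case True
      then have "ereal \<epsilon> < b1" using \<epsilon>(2) by (auto simp: m_def)
      then have "0 < psi h p q K z \<epsilon>" by (rule critical_pairD(5)[OF P1 \<epsilon>(1)])
      with z show False by simp
    next
      case False
      with \<open>a1 \<le> b1\<close> \<epsilon>(1) have "b1 < ereal \<epsilon>" by simp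
      then have "z < 0" using z by (rule critical_pairD(7)[OF P1])
      with two(2)[OF z] show False by simp
    qed
  qed
  have a: "a = a'" using fst_le[OF P P'] fst_le[OF P' P] by (rule order_antisym[rotated])
  have snd_le: "b2 \<le> b1" if P1: "critical_pair h p q K a b1" and P2: "critical_pair h p q K a b2" for b1 b2
  proof (rule ccontr)
    assume "\<not> ?thesis"
    then have "b1 < b2" by simp
    then obtain \<epsilon> :: real where \<epsilon>: "b1 < ereal \<epsilon>" "ereal \<epsilon> < b2" using ereal_dense2 by blast
    have "card {z. psi h p q K z \<epsilon> = 0} = 2" by (rule critical_pairD(6)[OF P1 \<epsilon>(1)])
    then have "{z. psi h p q K z \<epsilon> = 0} \<noteq> {}" by (intro notI) simp
    then obtain z where z: "psi h p q K z \<epsilon> = 0" by blast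
    have "a \<le> b1" by (rule critical_pairD(2)[OF P1])
    then have "a < ereal \<epsilon>" using \<epsilon>(1) by (rule le_less_trans)
    then have "0 < psi h p q K z \<epsilon>" using \<epsilon>(2) by (rule critical_pairD(5)[OF P2])
    with z show False by simp
  qed
  have P'': "critical_pair h p q K a b'" using P' a by simp
  show ?thesis using a order_antisym[OF snd_le[OF P'' P] snd_le[OF P P'']] ..
qed

section \<open>Existence of the critical pair and positivity on half-lines\<close>

locale linearization =
  fixes h p q :: real and K :: "real \<Rightarrow> real"
  assumes h: "0 \<le> h" and q: "0 < q" and pq: "q < p"
    and K_nonneg: "\<And>s. 0 \<le> K s"
    and K_int: "\<And>r. integrable lebesgue (\<lambda>s. K s * exp (r * s))"
    and K_mass: "(LINT s|lebesgue. K s) = 1"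
begin

abbreviation X where "X \<equiv> chi h p q K"

abbreviation k where "k l \<equiv> LINT s|lebesgue. K s * exp (- (l * s))"

lemma k_nonneg: "0 \<le> k l"
  by (intro Bochner_Integration.integral_nonneg mult_nonneg_nonneg K_nonneg) simp

lemma X_0: "0 < X c 0"
  using pq K_mass by (simp add: chi_def)

lemma convex_on_X: "convex_on UNIV (X c)"
proof -
  \<comment> \<open>Moving the delay factor into the integral makes the term a Laplace transform
    with the shift \<open>c * h + s\<close>.\<close>
  have 1: "p * exp (- (l * (c * h))) * k l = p * (LINT s|lebesgue. K s * exp (- (l * (c * h + s))))" for l
  proof -
    have "K s * exp (- (l * (c * h + s))) = exp (- (l * (c * h))) * (K s * exp (- (l * s)))" for s
      by (simp add: algebra_simps mult_exp_exp)
    then have "(LINT s|lebesgue. K s * exp (- (l * (c * h + s)))) = exp (- (l * (c * h))) * k l"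
      by (simp only: integral_mult_right_zero)
    then show ?thesis by simp
  qed
  have 2: "integrable lebesgue (\<lambda>s. K s * exp (r * (c * h + s)))" for r
  proof -
    have "K s * exp (r * (c * h + s)) = exp (r * (c * h)) * (K s * exp (r * s))" for s
      by (simp add: algebra_simps mult_exp_exp)
    then show ?thesis by (simp only: integrable_mult_right K_int)
  qed
  have "convex_on UNIV (\<lambda>l. l\<^sup>2 - c * l - q)"
    by (rule convex_on_realI[where f' = "\<lambda>l. 2 * l - c"]) (auto intro!: derivative_eq_intros)
  moreover have "convex_on UNIV (\<lambda>l. p * (LINT s|lebesgue. K s * exp (- (l * (c * h + s)))))"
    using q pq by (intro convex_on_cmul convex_on_laplace_transform K_nonneg 2) auto
  ultimately show ?thesis
    unfolding chi_def[abs_def] 1 by (rule convex_on_add)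
qed

text \<open>Far from the origin the quadratic part alone is positive, and the integral term is
  nonnegative.\<close>

lemma X_growth: "\<exists>x>y. 0 < X c x" "\<exists>x<y. 0 < X c x"
proof -
  have *: "0 < X c x" if "\<bar>c\<bar> + q + 1 \<le> \<bar>x\<bar>" for x
  proof -
    have "q + 1 \<le> \<bar>x\<bar> - \<bar>c\<bar>" "1 \<le> \<bar>x\<bar>" using that q by auto
    then have "1 * (q + 1) \<le> \<bar>x\<bar> * (\<bar>x\<bar> - \<bar>c\<bar>)" using q by (intro mult_mono) auto
    also have "\<dots> \<le> x\<^sup>2 - c * x"
      using abs_ge_self[of "c * x"] by (simp add: abs_mult right_diff_distrib power2_eq_square mult.commute)
    finally have "0 < x\<^sup>2 - c * x - q" by simp
    moreover have "0 \<le> p * exp (- (x * (c * h))) * k x" using q pq k_nonneg by simp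
    ultimately show ?thesis by (simp add: chi_def)
  qed
  show "\<exists>x>y. 0 < X c x"
    using q by (intro exI[of _ "\<bar>y\<bar> + \<bar>c\<bar> + q + 1"] conjI *) auto
  show "\<exists>x<y. 0 < X c x"
    using q by (intro exI[of _ "- (\<bar>y\<bar> + \<bar>c\<bar> + q + 1)"] conjI *) auto
qed

lemma X_two_zeros_pos:
  "0 < x \<Longrightarrow> X c x < 0 \<Longrightarrow> card {l. X c l = 0} = 2 \<and> (\<forall>l. X c l = 0 \<longrightarrow> 0 < l)"
  using convex_on_real_two_zeros_pos[OF convex_on_X X_0, of x c] X_growth(1)[of x c] by blast

lemma X_two_zeros_neg:
  "x < 0 \<Longrightarrow> X c x < 0 \<Longrightarrow> card {l. X c l = 0} = 2 \<and> (\<forall>l. X c l = 0 \<longrightarrow> l < 0)"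
  using convex_on_real_two_zeros_neg[OF convex_on_X X_0, of x c] X_growth(2)[of x c] by blast

text \<open>For positive \<open>l\<close> the term \<open>- c * l\<close> is strictly decreasing in
  \<open>c\<close>, and the delay factor is nonincreasing because \<open>h\<close> is
  nonnegative.\<close>

lemma X_strict_mono_pos:
  assumes "0 < l" "c' < c"
  shows "X c l < X c' l"
proof -
  have "c' * l < c * l" using assms by simp
  moreover have "exp (- (l * (c * h))) \<le> exp (- (l * (c' * h)))"
    using assms h by (simp add: mult_left_mono mult_right_mono)
  then have "p * exp (- (l * (c * h))) * k l \<le> p * exp (- (l * (c' * h))) * k l"
    using q pq k_nonneg by (intro mult_right_mono mult_left_mono) auto
  ultimately show ?thesis by (simp add: chi_def)
qed

lemma X_strict_mono_neg:
  assumes "l < 0" "c' < c"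
  shows "X c' l < X c l"
proof -
  have "c * l < c' * l" using assms by simp
  moreover have "exp (- (l * (c' * h))) \<le> exp (- (l * (c * h)))"
    using assms h by (simp add: mult_left_mono_neg mult_right_mono)
  then have "p * exp (- (l * (c' * h))) * k l \<le> p * exp (- (l * (c * h))) * k l"
    using q pq k_nonneg by (intro mult_right_mono mult_left_mono) auto
  ultimately show ?thesis by (simp add: chi_def)
qed

text \<open>The two dip sets are, up to endpoints, the regimes of positive and of negative roots.
  Monotonicity in the speed makes one closed downwards among positive numbers and the other closed
  upwards; convexity makes them disjoint.\<close>

definition eps_dip_right :: "real set" where "eps_dip_right = {\<epsilon>. 0 < \<epsilon> \<and> (\<exists>l>0. X (1 / sqrt \<epsilon>) l < 0)}"

definition eps_dip_left :: "real set" where "eps_dip_left = {\<epsilon>. 0 < \<epsilon> \<and> (\<exists>l<0. X (1 / sqrt \<epsilon>) l < 0)}"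

lemma speed_less: "0 < \<epsilon>' \<Longrightarrow> \<epsilon>' < \<epsilon> \<Longrightarrow> 1 / sqrt \<epsilon> < 1 / sqrt (\<epsilon>' :: real)"
  by (simp add: frac_less2)

lemma eps_dip_right_down: "\<epsilon> \<in> eps_dip_right \<Longrightarrow> 0 < \<epsilon>' \<Longrightarrow> \<epsilon>' < \<epsilon> \<Longrightarrow> \<epsilon>' \<in> eps_dip_right"
  unfolding eps_dip_right_def using X_strict_mono_pos[OF _ speed_less, of _ \<epsilon>' \<epsilon>] by (blast intro: less_trans)

lemma eps_dip_left_up: "\<epsilon> \<in> eps_dip_left \<Longrightarrow> \<epsilon> < \<epsilon>' \<Longrightarrow> \<epsilon>' \<in> eps_dip_left"
  unfolding eps_dip_left_def using X_strict_mono_neg[OF _ speed_less, of _ \<epsilon> \<epsilon>'] by (blast intro: less_trans)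

lemma eps_dip_disjoint:
  assumes "\<epsilon> \<in> eps_dip_right" "\<epsilon> \<in> eps_dip_left"
  shows False
proof -
  obtain a b where "b < 0" "0 < a" "X (1 / sqrt \<epsilon>) a < 0" "X (1 / sqrt \<epsilon>) b < 0"
    using assms by (auto simp: eps_dip_right_def eps_dip_left_def)
  then have "X (1 / sqrt \<epsilon>) 0 < 0"
    using convex_on_real_chord_neg[OF convex_on_X, of b 0 a] by simp
  with X_0 show False by (meson less_asym)
qed

lemma eps_dip_right_nonempty: "eps_dip_right \<noteq> {}"
proof -
  \<comment> \<open>With this speed the value at \<open>l = 1\<close> is at most
    \<open>- q\<close>.\<close>
  define c where "c = 1 + p * k 1"
  have c: "0 < c" using q pq k_nonneg[of 1] by (simp add: c_def add_pos_nonneg)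
  have "p * exp (- (1 * (c * h))) * k 1 \<le> p * 1 * k 1"
    using q pq k_nonneg[of 1] c h by (intro mult_right_mono mult_left_mono) auto
  then have "X c 1 < 0" using q by (simp add: chi_def c_def)
  then have "1 / c\<^sup>2 \<in> eps_dip_right" using c by (auto simp: eps_dip_right_def real_sqrt_divide intro!: exI[of _ 1])
  then show ?thesis by blast
qed

definition e0 :: ereal where "e0 = Sup (ereal ` eps_dip_right)"

text \<open>When there is no dip on the left, the infimum of the empty set gives the required value
  infinity.\<close>

definition e1 :: ereal where "e1 = Inf (ereal ` eps_dip_left)"

lemma less_e0: "0 < \<epsilon> \<Longrightarrow> ereal \<epsilon> < e0 \<Longrightarrow> \<epsilon> \<in> eps_dip_right"
  unfolding e0_def less_Sup_iff using eps_dip_right_down by auto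

lemma e1_less: "e1 < ereal \<epsilon> \<Longrightarrow> \<epsilon> \<in> eps_dip_left"
  unfolding e1_def Inf_less_iff using eps_dip_left_up by auto

text \<open>Lying outside the dip set gives only nonnegativity. An intermediate parameter, also
  above \<open>e0\<close>, and strict monotonicity in the speed make it strict.\<close>

lemma X_pos_right:
  assumes "e0 < ereal \<epsilon>" "0 \<le> l"
  shows "0 < X (1 / sqrt \<epsilon>) l"
proof (cases "l = 0")
  case False
  with assms(2) have l: "0 < l" by simp
  obtain \<epsilon>' :: real where \<epsilon>': "e0 < ereal \<epsilon>'" "ereal \<epsilon>' < ereal \<epsilon>" using ereal_dense2[OF assms(1)] by blast
  obtain a where "a \<in> eps_dip_right" using eps_dip_right_nonempty by blast
  then have "0 < a" "ereal a \<le> e0" by (auto simp: eps_dip_right_def e0_def intro: Sup_upper)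
  then have "0 < a" "ereal a < ereal \<epsilon>'" using \<epsilon>'(1) le_less_trans by blast+
  then have pos: "0 < \<epsilon>'" by simp
  have "\<epsilon>' \<notin> eps_dip_right" using \<epsilon>'(1) unfolding e0_def by (meson Sup_upper image_eqI not_le)
  then have "0 \<le> X (1 / sqrt \<epsilon>') l" using pos l by (force simp: eps_dip_right_def)
  also have "\<dots> < X (1 / sqrt \<epsilon>) l" using X_strict_mono_pos[OF l] speed_less pos \<epsilon>'(2) by simp
  finally show ?thesis .
qed (simp add: X_0)

lemma X_pos_left:
  assumes "0 < \<epsilon>" "ereal \<epsilon> < e1" "l \<le> 0"
  shows "0 < X (1 / sqrt \<epsilon>) l"
proof (cases "l = 0")
  case False
  with assms(3) have l: "l < 0" by simp
  obtain \<epsilon>' :: real where \<epsilon>': "ereal \<epsilon> < ereal \<epsilon>'" "ereal \<epsilon>' < e1" using ereal_dense2[OF assms(2)] by blast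
  have "\<epsilon>' \<notin> eps_dip_left" using \<epsilon>'(2) unfolding e1_def by (meson Inf_lower image_eqI not_le)
  then have "0 \<le> X (1 / sqrt \<epsilon>') l" using \<epsilon>'(1) assms(1) l by (force simp: eps_dip_left_def)
  also have "\<dots> < X (1 / sqrt \<epsilon>) l" using X_strict_mono_neg[OF l] speed_less assms(1) \<epsilon>'(1) by simp
  finally show ?thesis .
qed (simp add: X_0)

lemma e0_pos: "0 < e0"
proof -
  obtain a where "a \<in> eps_dip_right" using eps_dip_right_nonempty by blast
  then have "0 < ereal a" "ereal a \<le> e0" by (auto simp: eps_dip_right_def e0_def intro: Sup_upper)
  then show ?thesis by (rule less_le_trans)
qed

lemma e0_le_e1: "e0 \<le> e1"
proof (rule ccontr)
  assume "\<not> ?thesis"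
  then have "e1 < e0" by simp
  then obtain \<epsilon> :: real where \<epsilon>: "e1 < ereal \<epsilon>" "ereal \<epsilon> < e0" using ereal_dense2 by blast
  have "\<epsilon> \<in> eps_dip_left" using e1_less[OF \<epsilon>(1)] .
  then have "\<epsilon> \<in> eps_dip_right" using less_e0 \<epsilon>(2) by (simp add: eps_dip_left_def)
  with eps_dip_disjoint \<open>\<epsilon> \<in> eps_dip_left\<close> show False by blast
qed

lemma critical_pair_e0_e1: "critical_pair h p q K e0 e1"
  unfolding critical_pair_def
proof (intro conjI allI impI; (elim conjE)?)
  show "0 < e0" by (rule e0_pos)
  show "e0 \<le> e1" by (rule e0_le_e1)
  fix \<epsilon> :: real
  {
    assume \<epsilon>: "0 < ereal \<epsilon>" "ereal \<epsilon> < e0"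
    then have "\<epsilon> \<in> eps_dip_right" using less_e0 by simp
    then obtain l where "0 < l" "X (1 / sqrt \<epsilon>) l < 0" by (auto simp: eps_dip_right_def)
    note * = X_two_zeros_pos[OF this]
    show "card {z. psi h p q K z \<epsilon> = 0} = 2" using card_psi_zeros[of \<epsilon>] * \<epsilon> by simp
    show "0 < z" if "psi h p q K z \<epsilon> = 0" for z
    proof -
      have "0 < \<epsilon>" using \<epsilon> by simp
      then have "0 < sqrt \<epsilon> * z" using * that by (simp only: psi_eq_chi)
      with \<open>0 < \<epsilon>\<close> show ?thesis by (simp add: zero_less_mult_iff)
    qed
  }
  {
    assume \<epsilon>: "e0 < ereal \<epsilon>" "ereal \<epsilon> < e1"
    have "0 < ereal \<epsilon>" using e0_pos \<epsilon>(1) by (rule less_trans)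
    then have "0 < \<epsilon>" by simp
    then show "0 < psi h p q K z \<epsilon>" for z
      using X_pos_right[OF \<epsilon>(1), of "sqrt \<epsilon> * z"] X_pos_left[OF _ \<epsilon>(2), of "sqrt \<epsilon> * z"]
      by (cases "0 \<le> sqrt \<epsilon> * z") (auto simp: psi_eq_chi)
  }
  {
    assume \<epsilon>: "e1 < ereal \<epsilon>"
    then have "\<epsilon> \<in> eps_dip_left" using e1_less by simp
    then obtain l where "0 < \<epsilon>" "l < 0" "X (1 / sqrt \<epsilon>) l < 0" by (auto simp: eps_dip_left_def)
    note * = X_two_zeros_neg[OF this(2,3)]
    show "card {z. psi h p q K z \<epsilon> = 0} = 2" using card_psi_zeros[OF \<open>0 < \<epsilon>\<close>] * by simp
    show "z < 0" if "psi h p q K z \<epsilon> = 0" for z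
    proof -
      have "sqrt \<epsilon> * z < 0" using * that \<open>0 < \<epsilon>\<close> by (simp only: psi_eq_chi)
      with \<open>0 < \<epsilon>\<close> show ?thesis by (simp add: mult_less_0_iff)
    qed
  }
qed

lemma critical_eps_eq: "critical_eps h p q K = (e0, e1)"
  unfolding critical_eps_def
proof (rule the_equality)
  show "critical_pair h p q K (fst (e0, e1)) (snd (e0, e1))" using critical_pair_e0_e1 by simp
  show "e = (e0, e1)" if "critical_pair h p q K (fst e) (snd e)" for e
    using critical_pair_unique[OF that critical_pair_e0_e1] by (simp add: prod_eq_iff)
qed

text \<open>The condition on \<open>c\<close> says that \<open>1 / c\<^sup>2\<close> exceeds
  \<open>e0\<close>. An infinite \<open>e0\<close> would give critical speed zero, which no positive
  \<open>c\<close> lies below.\<close>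

lemma X_pos_below_c_star:
  assumes "0 < c" "c < c_star h p q K" "0 \<le> l"
  shows "0 < X c l"
proof -
  have "e0 \<noteq> \<infinity>" using assms(1,2) by (auto simp: c_star_def critical_eps_eq inv_sqrt_def)
  then obtain r where r: "e0 = ereal r" "0 < r" using e0_pos by (cases e0) auto
  then have "c < 1 / sqrt r" using assms(2) by (simp add: c_star_def critical_eps_eq inv_sqrt_def)
  then have "c * sqrt r < 1" using r by (simp add: field_simps)
  then have "(c * sqrt r)\<^sup>2 < 1" using assms(1) r by (simp add: power_less_one_iff abs_square_less_1)
  then have "r < 1 / c\<^sup>2" using assms(1) r by (simp add: power_mult_distrib field_simps)
  then show ?thesis
    using X_pos_right[of "1 / c\<^sup>2" l] assms(1,3) r by (simp add: real_sqrt_divide)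
qed

text \<open>The condition on \<open>c\<close> says that \<open>1 / c\<^sup>2\<close> is below
  \<open>e1\<close>; this is immediate when \<open>e1\<close> is infinite.\<close>

lemma X_pos_above_c_sharp:
  assumes "0 < c" "c_sharp h p q K < c" "l \<le> 0"
  shows "0 < X c l"
proof -
  have "ereal (1 / c\<^sup>2) < e1"
  proof (cases "e1 = \<infinity>")
    case False
    then obtain r where r: "e1 = ereal r" "0 < r"
      using less_le_trans[OF e0_pos e0_le_e1] by (cases e1) auto
    then have "1 / sqrt r < c" using assms(2) by (simp add: c_sharp_def critical_eps_eq inv_sqrt_def)
    then have "1 < c * sqrt r" using r by (simp add: field_simps)
    then have "1 < (c * sqrt r)\<^sup>2" by (simp add: one_less_power)
    then show ?thesis using assms(1) r by (simp add: power_mult_distrib field_simps)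
  qed simp
  then show ?thesis
    using X_pos_left[of "1 / c\<^sup>2" l] assms(1,3) by (simp add: real_sqrt_divide)
qed

end

section \<open>Travelling solutions\<close>

text \<open>The equation is read at time zero: the chain rule turns the time derivative into
  \<open>c\<close> times the space derivative, and the substitution \<open>y = x - s\<close> turns
  the convolution into an integral over the shift \<open>c * h + s\<close>.\<close>

lemma travelling_solution_profile_equation:
  assumes "travelling_solution h q F K f \<phi> c"
  obtains \<phi>1 \<phi>2 where "\<And>t. (\<phi> has_real_derivative \<phi>1 t) (at t)"
    "\<And>t. (\<phi>1 has_real_derivative \<phi>2 t) (at t)"
    "\<And>t. c * \<phi>1 t = \<phi>2 t - q * \<phi> t
        + F (\<phi> t, \<chi> j. LINT s|lebesgue. K j s * f j (\<phi> (t - (c * h + s))))"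
proof -
  obtain ut ux uxx where
    ut: "\<And>t x. ((\<lambda>t. \<phi> (x + c * t)) has_real_derivative ut t x) (at t)"
    and ux: "\<And>t x. ((\<lambda>x. \<phi> (x + c * t)) has_real_derivative ux t x) (at x)"
    and uxx: "\<And>t x. ((\<lambda>x. ux t x) has_real_derivative uxx t x) (at x)"
    and eq: "\<And>t x. ut t x = uxx t x - q * \<phi> (x + c * t)
             + F (\<phi> (x + c * t), \<chi> j. nonlocal_op h (K j) (f j) (\<lambda>t x. \<phi> (x + c * t)) t x)"
    using assms unfolding travelling_solution_def classical_solution_def by blast
  have d1: "(\<phi> has_real_derivative ux 0 t) (at t)" for t
    using ux[of 0 t] by simp
  have d2: "(ux 0 has_real_derivative uxx 0 t) (at t)" for t
    using uxx[of 0 t] by simp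
  have ut0: "ut 0 x = c * ux 0 x" for x
  proof (rule DERIV_unique[OF ut])
    have "((\<lambda>t. x + c * t) has_real_derivative c) (at 0)"
      by (auto intro!: derivative_eq_intros)
    then show "((\<lambda>t. \<phi> (x + c * t)) has_real_derivative c * ux 0 x) (at 0)"
      using DERIV_chain2[of \<phi> "ux 0 x" "\<lambda>t. x + c * t" 0 c UNIV] d1[of x] by (simp add: mult.commute)
  qed
  have nonlocal: "nonlocal_op h (K j) (f j) (\<lambda>t x. \<phi> (x + c * t)) 0 x
      = (LINT s|lebesgue. K j s * f j (\<phi> (x - (c * h + s))))" for j x
    unfolding nonlocal_op_def
    by (subst lebesgue_integral_real_affine[of "-1" _ x]) (simp_all add: algebra_simps)
  have "c * ux 0 t = uxx 0 t - q * \<phi> t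
      + F (\<phi> t, \<chi> j. LINT s|lebesgue. K j s * f j (\<phi> (t - (c * h + s))))" for t
    using eq[of 0 t] unfolding ut0 nonlocal by simp
  with d1 d2 show ?thesis using that by blast
qed

theorem theorem1:
  fixes h q p :: real
    and F DF :: "real \<times> (real ^ 'm) \<Rightarrow> real"
    and f K :: "'m \<Rightarrow> real \<Rightarrow> real"
    and f' :: "'m \<Rightarrow> real"
    and Kbar :: "real \<Rightarrow> real"
  assumes "h \<ge> 0" and "q > 0"
    and "continuous_on orthant F" and "\<And>v. v \<in> orthant \<Longrightarrow> F v \<ge> 0" and "F 0 = 0"
    and "(F has_derivative DF) (at 0 within orthant)"
    and "DF (1, 0) = 0" and "\<And>j. DF (0, axis j 1) \<ge> 0"
    and "\<And>j. continuous_on {0..} (f j)" and "\<And>j s. s \<ge> 0 \<Longrightarrow> f j s \<ge> 0" and "\<And>j. f j 0 = 0"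
    and "\<And>j. (f j has_real_derivative f' j) (at 0 within {0..})" and "\<And>j. f' j \<ge> 0"
    and "\<And>j s. K j s \<ge> 0"
    and "\<And>j r. integrable lebesgue (\<lambda>s. K j s * exp (r * s))"
    and "\<And>j. (LINT s|lebesgue. K j s) = 1"
    and "p = (\<Sum>j\<in>UNIV. DF (0, axis j 1) * f' j)" and "p > q"
    and "Kbar = (\<lambda>s. inverse p * (\<Sum>j\<in>UNIV. DF (0, axis j 1) * f' j * K j s))"
  shows "(\<forall>\<phi> c. c > 0 \<and> travelling_solution h q F K f \<phi> c \<longrightarrow>
            (c < c_star h p q Kbar \<longrightarrow>
               Liminf at_bot (\<lambda>s. ereal (\<phi> s)) > 0 \<and> \<not> semi_wavefront h q F K f \<phi> c) \<and>
            (c > c_sharp h p q Kbar \<longrightarrow> Liminf at_top (\<lambda>s. ereal (\<phi> s)) > 0)) \<and>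
         \<not> (\<exists>\<phi> c. c \<noteq> 0 \<and> pulse h q F K f \<phi> c)"
proof -
  let ?a = "\<lambda>j. DF (0, axis j 1) * f' j"
  have p: "0 < p" using assms(2,18) by simp
  have K_int: "integrable lebesgue (\<lambda>s. K j s * exp (- (l * s)))" for j l
    using assms(15)[of j "- l"] by simp
  \<comment> \<open>The factor \<open>p\<close> cancels the normalisation of \<open>Kbar\<close>, so
    \<open>chi\<close> for the averaged kernel is the characteristic function of the system of
    kernels.\<close>
  have p_Kbar: "p * (LINT s|lebesgue. Kbar s * exp (- (l * s)))
      = (\<Sum>j\<in>UNIV. ?a j * (LINT s|lebesgue. K j s * exp (- (l * s))))" for l
  proof -
    have "Kbar s * exp (- (l * s)) = inverse p * (\<Sum>j\<in>UNIV. ?a j * (K j s * exp (- (l * s))))" for s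
      by (simp add: assms(19) sum_distrib_right mult.assoc)
    then have "(LINT s|lebesgue. Kbar s * exp (- (l * s)))
        = inverse p * (LINT s|lebesgue. (\<Sum>j\<in>UNIV. ?a j * (K j s * exp (- (l * s)))))"
      by simp
    also have "(LINT s|lebesgue. (\<Sum>j\<in>UNIV. ?a j * (K j s * exp (- (l * s)))))
        = (\<Sum>j\<in>UNIV. ?a j * (LINT s|lebesgue. K j s * exp (- (l * s))))"
      by (subst Bochner_Integration.integral_sum) (auto intro: integrable_mult_right K_int)
    finally show ?thesis using p by simp
  qed
  interpret lin: linearization h p q Kbar
  proof
    show "0 \<le> Kbar s" for s
      unfolding assms(19) using p assms(8,13,14) by (intro mult_nonneg_nonneg sum_nonneg) auto
    have "Kbar s * exp (r * s) = inverse p * (\<Sum>j\<in>UNIV. ?a j * (K j s * exp (r * s)))" for r s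
      by (simp add: assms(19) sum_distrib_right mult.assoc)
    then show "integrable lebesgue (\<lambda>s. Kbar s * exp (r * s))" for r
      using assms(15) by (simp only:) (intro integrable_mult_right Bochner_Integration.integrable_sum)
    show "(LINT s|lebesgue. Kbar s) = 1"
      using p_Kbar[of 0] assms(16,17) p by simp
  qed (use assms(1,2,18) in auto)
  have profile: "\<exists>\<phi>1 \<phi>2. profile F DF f K f' (\<lambda>s. c * h + s) \<phi> \<phi>1 \<phi>2 c q"
    if sol: "travelling_solution h q F K f \<phi> c" for \<phi> c
  proof -
    obtain \<phi>1 \<phi>2 where *: "\<And>t. (\<phi> has_real_derivative \<phi>1 t) (at t)"
      "\<And>t. (\<phi>1 has_real_derivative \<phi>2 t) (at t)"
      "\<And>t. c * \<phi>1 t = \<phi>2 t - q * \<phi> t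
        + F (\<phi> t, \<chi> j. LINT s|lebesgue. K j s * f j (\<phi> (t - (c * h + s))))"
      using travelling_solution_profile_equation[OF sol] by blast
    have int: "integrable lebesgue (\<lambda>s. K j s * exp (r * (c * h + s)))" for j r
    proof -
      have "K j s * exp (r * (c * h + s)) = exp (r * (c * h)) * (K j s * exp (r * s))" for s
        by (simp add: algebra_simps mult_exp_exp)
      then show ?thesis by (simp only: integrable_mult_right assms(15))
    qed
    have "profile F DF f K f' (\<lambda>s. c * h + s) \<phi> \<phi>1 \<phi>2 c q"
      using sol unfolding travelling_solution_def
      by unfold_locales (use assms * int in \<open>auto intro!: continuous_intros\<close>)
    then show ?thesis by blast
  qed
  \<comment> \<open>This identity transfers the sign information at the critical speeds to the
    profile.\<close>
  have char: "profile.char_fun DF K f' (\<lambda>s. c * h + s) c q l = chi h p q Kbar c l"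
    if prof: "profile F DF f K f' (\<lambda>s. c * h + s) \<phi> \<phi>1 \<phi>2 c q" for \<phi> \<phi>1 \<phi>2 c l
  proof -
    interpret profile F DF f K f' "\<lambda>s. c * h + s" \<phi> \<phi>1 \<phi>2 c q by (rule prof)
    have "(LINT s|lebesgue. K j s * exp (- (l * (c * h + s))))
        = exp (- (l * (c * h))) * (LINT s|lebesgue. K j s * exp (- (l * s)))" for j
    proof -
      have "K j s * exp (- (l * (c * h + s))) = exp (- (l * (c * h))) * (K j s * exp (- (l * s)))" for s
        by (simp add: algebra_simps mult_exp_exp)
      then show ?thesis by (simp only: integral_mult_right_zero)
    qed
    then have "char_fun l = l\<^sup>2 - c * l - q
        + exp (- (l * (c * h))) * (\<Sum>j\<in>UNIV. ?a j * (LINT s|lebesgue. K j s * exp (- (l * s))))"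
      unfolding char_fun_def by (simp add: sum_distrib_left mult_ac)
    then show ?thesis unfolding p_Kbar[symmetric] chi_def by (simp add: mult_ac)
  qed
  have left: "\<exists>e>0. \<exists>T. \<forall>t\<le>T. e \<le> \<phi> t"
    if c: "c > 0" "c < c_star h p q Kbar" and sol: "travelling_solution h q F K f \<phi> c" for \<phi> c
  proof -
    obtain \<phi>1 \<phi>2 where prof: "profile F DF f K f' (\<lambda>s. c * h + s) \<phi> \<phi>1 \<phi>2 c q"
      using profile[OF sol] by blast
    show ?thesis
      by (rule profile.liminf_at_left_pos[OF prof])
        (simp add: char[OF prof] lin.X_pos_below_c_star[OF c])
  qed
  have right: "\<exists>e>0. \<exists>T. \<forall>t\<ge>T. e \<le> \<phi> t"
    if c: "c > 0" "c > c_sharp h p q Kbar" and sol: "travelling_solution h q F K f \<phi> c" for \<phi> c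
  proof -
    obtain \<phi>1 \<phi>2 where prof: "profile F DF f K f' (\<lambda>s. c * h + s) \<phi> \<phi>1 \<phi>2 c q"
      using profile[OF sol] by blast
    show ?thesis
      by (rule profile.liminf_at_right_pos[OF prof])
        (simp add: char[OF prof] lin.X_pos_above_c_sharp[OF c])
  qed
  have Liminf_pos: "0 < Liminf G (\<lambda>s. ereal (\<phi> s))"
    if "e > 0" "eventually (\<lambda>s. e \<le> \<phi> s) G" for G :: "real filter" and e and \<phi> :: "real \<Rightarrow> real"
  proof -
    have "ereal e \<le> Liminf G (\<lambda>s. ereal (\<phi> s))"
      using that(2) by (intro Liminf_bounded) (auto elim: eventually_mono)
    then show ?thesis using that(1) by (metis ereal_less(2) less_le_trans)
  qed
  have "0 < Liminf at_bot (\<lambda>s. ereal (\<phi> s))"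
    if c: "c > 0" "c < c_star h p q Kbar" and sol: "travelling_solution h q F K f \<phi> c" for \<phi> c
    using left[OF that] Liminf_pos[of _ \<phi> at_bot] unfolding eventually_at_bot_linorder by blast
  moreover have "\<not> semi_wavefront h q F K f \<phi> c" if c: "c > 0" "c < c_star h p q Kbar" for \<phi> c
  proof
    assume semi: "semi_wavefront h q F K f \<phi> c"
    then obtain e T where e: "e > 0" "\<And>t. t \<le> T \<Longrightarrow> e \<le> \<phi> t"
      using left[OF c] unfolding semi_wavefront_def by blast
    have "eventually (\<lambda>t. e \<le> \<phi> t) at_bot"
      using e(2) unfolding eventually_at_bot_linorder by blast
    moreover have "eventually (\<lambda>t. \<phi> t < e) at_bot"
      using semi e(1) unfolding semi_wavefront_def by (intro order_tendstoD(2)) auto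
    ultimately have "eventually (\<lambda>t::real. False) at_bot" by eventually_elim simp
    then show False by simp
  qed
  moreover have "0 < Liminf at_top (\<lambda>s. ereal (\<phi> s))"
    if c: "c > 0" "c > c_sharp h p q Kbar" and sol: "travelling_solution h q F K f \<phi> c" for \<phi> c
    using right[OF that] Liminf_pos[of _ \<phi> at_top] unfolding eventually_at_top_linorder by blast
  moreover have False if pulse: "pulse h q F K f \<phi> c" for \<phi> c
  proof -
    have sol: "travelling_solution h q F K f \<phi> c" and lims: "(\<phi> \<longlongrightarrow> 0) at_bot" "(\<phi> \<longlongrightarrow> 0) at_top"
      using pulse unfolding pulse_def semi_wavefront_def by auto
    obtain \<phi>1 \<phi>2 where prof: "profile F DF f K f' (\<lambda>s. c * h + s) \<phi> \<phi>1 \<phi>2 c q"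
      using profile[OF sol] by blast
    show False
      by (rule profile.not_pulse[OF prof _ lims]) (simp add: char[OF prof] lin.X_0)
  qed
  ultimately show ?thesis by blast
qed

end
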